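(* Let $n\ge 1$, let $\alpha,\beta>0$ and $q_0,q_1\in[1,+\infty]$. Let $\theta=\frac{\alpha}{\alpha+\beta}\in(0,1)$ and let $p\in[1,+\infty]$ be defined by $\frac1p=\frac{1-\theta}{q_0}+\frac{\theta}{q_1}$. Then there exists a constant $C_0$ (not depending on $f$) such that every $f\in\dot F^{\alpha,q_0}_\infty\cap\dot F^{-\beta,q_1}_\infty(\mathbb{R}^n)$ is a function satisfying, for almost every $x\in\mathbb{R}^n$, $$|f(x)|\le C_0\Big(\sup_{j\in\mathbb{Z}}2^{j\alpha}|\Delta_jf(x)|\Big)^{1-\theta}\Big(\sup_{j\in\mathbb{Z}}2^{-j\beta}|\Delta_jf(x)|\Big)^{\theta}.$$ In particular, $$\|f\|_{L^p}\le C_0\,\|f\|_{\dot F^{\alpha,q_0}_\infty}^{1-\theta}\,\|f\|_{\dot F^{-\beta,q_1}_\infty}^{\theta}.$$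
   Context: Littlewood–Paley decomposition: fix a nonnegative $\varphi\in C_c^\infty(\mathbb{R}^n)$ with $\varphi(\xi)=1$ for $|\xi|\le 1/2$ and $\varphi(\xi)=0$ for $|\xi|\ge 1$, and put $\psi(\xi)=\varphi(\xi/2)-\varphi(\xi)$. For $f\in\mathcal{S}'(\mathbb{R}^n)$ and $j\in\mathbb{Z}$, the dyadic block $\Delta_jf$ is defined by $\widehat{\Delta_jf}(\xi)=\psi(2^{-j}\xi)\widehat f(\xi)$. For $s\in\mathbb{R}$ and $q\in[1,+\infty]$, the semi-norm of the homogeneous Triebel–Lizorkin space $\dot F^{s,q}_\infty(\mathbb{R}^n)$ (first upper index: regularity; second upper index: Lebesgue exponent; lower index: summation exponent in $j$, here $\infty$) is $$\|f\|_{\dot F^{s,q}_\infty}=\Big\|\sup_{j\in\mathbb{Z}}2^{js}|\Delta_jf|\Big\|_{L^q(\mathbb{R}^n)}.$$ Convention: $f\in\dot F^{\alpha,q_0}_\infty\cap\dot F^{-\beta,q_1}_\infty$ means that $f\in\mathcal{S}'(\mathbb{R}^n)$ satisfies $f=\sum_{j\in\mathbb{Z}}\Delta_jf$ (convergence in $\mathcal{S}'$) and that both semi-norms $\|f\|_{\dot F^{\alpha,q_0}_\infty}$ and $\|f\|_{\dot F^{-\beta,q_1}_\infty}$ are finite. *)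

theory Defs
  imports "HOL-Analysis.Analysis" "HOL-Probability.Essential_Supremum"
begin

section \<open>Schwartz functions and tempered distributions\<close>

definition partial_deriv ::
    "'n::finite \<Rightarrow> (real ^ 'n \<Rightarrow> 'b::real_normed_vector) \<Rightarrow> real ^ 'n \<Rightarrow> 'b" where
  "partial_deriv i f x = frechet_derivative f (at x) (axis i 1)"

text \<open>Mixed partial derivatives are indexed by lists of directions instead of multi-indices.\<close>

fun partial_derivs ::
    "'n::finite list \<Rightarrow> (real ^ 'n \<Rightarrow> 'b::real_normed_vector) \<Rightarrow> real ^ 'n \<Rightarrow> 'b" where
  "partial_derivs [] f = f"
| "partial_derivs (i # is) f = partial_deriv i (partial_derivs is f)"

definition smooth :: "(real ^ 'n::finite \<Rightarrow> 'b::real_normed_vector) \<Rightarrow> bool" where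
  "smooth f \<longleftrightarrow> (\<forall>is x. partial_derivs is f differentiable (at x))"

definition smooth_compact_support :: "(real ^ 'n::finite \<Rightarrow> 'b::real_normed_vector) \<Rightarrow> bool" where
  "smooth_compact_support f \<longleftrightarrow> smooth f \<and> compact (closure {x. f x \<noteq> 0})"

definition schwartz :: "(real ^ 'n::finite \<Rightarrow> complex) \<Rightarrow> bool" where
  "schwartz \<phi> \<longleftrightarrow> smooth \<phi> \<and>
     (\<forall>(k::nat) is. bdd_above (range (\<lambda>x. (1 + norm x) ^ k * norm (partial_derivs is \<phi> x))))"

definition schwartz_seminorm :: "nat \<Rightarrow> 'n::finite list \<Rightarrow> (real ^ 'n \<Rightarrow> complex) \<Rightarrow> real" where
  "schwartz_seminorm k is \<phi> = (SUP x. (1 + norm x) ^ k * norm (partial_derivs is \<phi> x))"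

text \<open>A tempered distribution is a linear functional on the Schwartz space that is continuous,
  i.e. dominated by finitely many of the seminorms. It is represented by a functional on all
  functions, whose values outside the Schwartz space are irrelevant.\<close>

type_synonym 'n distr = "(real ^ 'n \<Rightarrow> complex) \<Rightarrow> complex"

definition tempered :: "'n::finite distr \<Rightarrow> bool" where
  "tempered u \<longleftrightarrow>
     (\<forall>\<phi> \<eta> a b. schwartz \<phi> \<longrightarrow> schwartz \<eta> \<longrightarrow>
        u (\<lambda>x. a * \<phi> x + b * \<eta> x) = a * u \<phi> + b * u \<eta>) \<and>
     (\<exists>(C::real) (N::nat). \<forall>\<phi>. schwartz \<phi> \<longrightarrow>
        norm (u \<phi>) \<le> C * (\<Sum>k\<le>N. \<Sum>is | length is \<le> N. schwartz_seminorm k is \<phi>))"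

text \<open>The distribution \<open>u\<close> is the function \<open>g\<close>. Integrability against every
  Schwartz function includes local integrability of \<open>g\<close>.\<close>

definition represents :: "(real ^ 'n::finite \<Rightarrow> complex) \<Rightarrow> 'n distr \<Rightarrow> bool" where
  "represents g u \<longleftrightarrow> g \<in> borel_measurable lborel \<and>
     (\<forall>\<phi>. schwartz \<phi> \<longrightarrow>
        integrable lborel (\<lambda>x. g x * \<phi> x) \<and> u \<phi> = (LINT x|lborel. g x * \<phi> x))"

text \<open>A distribution has at most one continuous representative, so for a distribution that
  is a continuous function the choice below is determined.\<close>

definition continuous_rep :: "'n::finite distr \<Rightarrow> real ^ 'n \<Rightarrow> complex" where
  "continuous_rep u = (SOME g. continuous_on UNIV g \<and> represents g u)"


section \<open>Fourier transform\<close>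

definition fourier :: "(real ^ 'n::finite \<Rightarrow> complex) \<Rightarrow> real ^ 'n \<Rightarrow> complex" where
  "fourier \<phi> \<xi> = (LINT x|lborel. exp (- (\<i> * complex_of_real (x \<bullet> \<xi>))) * \<phi> x)"

definition inv_fourier :: "(real ^ 'n::finite \<Rightarrow> complex) \<Rightarrow> real ^ 'n \<Rightarrow> complex" where
  "inv_fourier \<phi> x =
     complex_of_real (1 / (2 * pi) ^ CARD('n)) *
     (LINT \<xi>|lborel. exp (\<i> * complex_of_real (x \<bullet> \<xi>)) * \<phi> \<xi>)"

definition fourier_distr :: "'n::finite distr \<Rightarrow> 'n distr" where
  "fourier_distr u = (\<lambda>\<phi>. u (fourier \<phi>))"

definition inv_fourier_distr :: "'n::finite distr \<Rightarrow> 'n distr" where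
  "inv_fourier_distr u = (\<lambda>\<phi>. u (inv_fourier \<phi>))"

definition mult_distr :: "(real ^ 'n::finite \<Rightarrow> real) \<Rightarrow> 'n distr \<Rightarrow> 'n distr" where
  "mult_distr m u = (\<lambda>\<phi>. u (\<lambda>\<xi>. complex_of_real (m \<xi>) * \<phi> \<xi>))"


section \<open>Littlewood--Paley decomposition\<close>

definition lp_cutoff :: "(real ^ 'n::finite \<Rightarrow> real) \<Rightarrow> bool" where
  "lp_cutoff \<phi> \<longleftrightarrow> smooth_compact_support \<phi> \<and> (\<forall>\<xi>. 0 \<le> \<phi> \<xi>) \<and>
     (\<forall>\<xi>. norm \<xi> \<le> 1 / 2 \<longrightarrow> \<phi> \<xi> = 1) \<and> (\<forall>\<xi>. norm \<xi> \<ge> 1 \<longrightarrow> \<phi> \<xi> = 0)"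

definition lp_psi :: "(real ^ 'n::finite \<Rightarrow> real) \<Rightarrow> real ^ 'n \<Rightarrow> real" where
  "lp_psi \<phi> \<xi> = \<phi> (\<xi> /\<^sub>R 2) - \<phi> \<xi>"

definition dyadic_block :: "(real ^ 'n::finite \<Rightarrow> real) \<Rightarrow> int \<Rightarrow> 'n distr \<Rightarrow> 'n distr" where
  "dyadic_block \<phi> j f =
     inv_fourier_distr (mult_distr (\<lambda>\<xi>. lp_psi \<phi> ((2 powi (- j)) *\<^sub>R \<xi>)) (fourier_distr f))"

text \<open>A dyadic block has compact spectrum, hence is a (smooth) function; this is the function
  whose values enter the pointwise suprema.\<close>

definition dyadic_block_fun ::
    "(real ^ 'n::finite \<Rightarrow> real) \<Rightarrow> int \<Rightarrow> 'n distr \<Rightarrow> real ^ 'n \<Rightarrow> complex" where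
  "dyadic_block_fun \<phi> j f = continuous_rep (dyadic_block \<phi> j f)"

definition lp_reconstructs :: "(real ^ 'n::finite \<Rightarrow> real) \<Rightarrow> 'n distr \<Rightarrow> bool" where
  "lp_reconstructs \<phi> f \<longleftrightarrow> (\<forall>\<eta>. schwartz \<eta> \<longrightarrow>
     ((\<lambda>(M::nat, N::nat). \<Sum>j\<in>{- int M..int N}. dyadic_block \<phi> j f \<eta>) \<longlongrightarrow> f \<eta>)
       (at_top \<times>\<^sub>F at_top))"


section \<open>Lebesgue norms and Triebel--Lizorkin seminorms\<close>

text \<open>Powers with a positive real exponent on \<open>[0, \<infinity>]\<close>.\<close>

definition epowr :: "ennreal \<Rightarrow> real \<Rightarrow> ennreal" where
  "epowr x a = (if x = \<infinity> then \<infinity> else ennreal (enn2real x powr a))"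

definition Lq_norm :: "ennreal \<Rightarrow> (real ^ 'n::finite \<Rightarrow> ennreal) \<Rightarrow> ennreal" where
  "Lq_norm q F =
     (if q = \<infinity> then esssup lborel F
      else epowr (\<integral>\<^sup>+ x. epowr (F x) (enn2real q) \<partial>lborel) (1 / enn2real q))"

definition tl_sup ::
    "(real ^ 'n::finite \<Rightarrow> real) \<Rightarrow> real \<Rightarrow> 'n distr \<Rightarrow> real ^ 'n \<Rightarrow> ennreal" where
  "tl_sup \<phi> s f x =
     (SUP j::int. ennreal (2 powr (real_of_int j * s) * norm (dyadic_block_fun \<phi> j f x)))"

definition tl_seminorm ::
    "(real ^ 'n::finite \<Rightarrow> real) \<Rightarrow> real \<Rightarrow> ennreal \<Rightarrow> 'n distr \<Rightarrow> ennreal" where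
  "tl_seminorm \<phi> s q f = Lq_norm q (tl_sup \<phi> s f)"

definition in_tl_inter ::
    "(real ^ 'n::finite \<Rightarrow> real) \<Rightarrow> real \<Rightarrow> ennreal \<Rightarrow> real \<Rightarrow> ennreal \<Rightarrow> 'n distr \<Rightarrow> bool" where
  "in_tl_inter \<phi> s0 q0 s1 q1 f \<longleftrightarrow> tempered f \<and> lp_reconstructs \<phi> f \<and>
     tl_seminorm \<phi> s0 q0 f < \<infinity> \<and> tl_seminorm \<phi> s1 q1 f < \<infinity>"

end

theory Submission
  imports Defs "HOL-Probability.Characteristic_Functions"
begin

text \<open>
  Writing $A$ and $B$ for the two suprema, $|\Delta_j f(x)| \le \min(2^{-j\alpha} A(x), 2^{j\beta} B(x))$,
  and summing this over $j$ (two geometric series meeting at $2^{j(\alpha+\beta)} \approx A/B$) gives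
  $\sum_j |\Delta_j f(x)| \le C_0 A(x)^{1-\theta} B(x)^{\theta}$, which is at most
  $C_0 (A(x) + B(x))$. Hence the Littlewood--Paley series converges almost everywhere and, by dominated
  convergence, also against Schwartz functions; its sum represents $f$. The $L^p$ bound is
  Hoelder's inequality.

  That $\Delta_j f$ is a continuous function needs no Fourier inversion: by Fubini, the Fourier
  transform of $m \cdot \mathcal{F}^{-1}\eta$ is $\eta * G$, where $G$ is a multiple of the Fourier
  transform of the compactly supported multiplier $m$, so that $\Delta_j f$ is $x \mapsto f(G(\cdot - x))$.
  The distribution is moved under the convolution integral by replacing the translation
  parameter with simple functions converging to the identity.
\<close>

subsection \<open>Partial derivatives and smooth functions\<close>

text \<open>A tempered distribution is represented by a functional that is linear and bounded only
  on Schwartz functions. Every function fed to \<open>f\<close> must therefore first be shown to be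
  Schwartz, and linearity moves \<open>f\<close> only past finite sums. The way out is finite order:
  \<open>f\<close> is controlled by finitely many weighted norms of some order \<open>N\<close>, so
  a limit may pass through \<open>f\<close> once it holds in those norms. The pairing of a dyadic
  block with \<eta> involves the inverse transform of \<eta> only below an absolutely convergent
  double integral. Rapid decay thus has to be proved for one transform only, that of the compactly
  supported multiplier. The constant depends on \<alpha> and \<beta> alone: around the real index
  where the two bounds on the blocks cross, they decay at rate at least
  \<open>min \<alpha> \<beta>\<close> on both sides. The sum A + B serves as dominating function
  because A and B can each be integrated against a Schwartz function for every exponent in
  [1, \<infinity>]. Identifying the sum with \<open>f\<close> is thereby independent of the final
  exponent \<open>p\<close>.\<close>

lemma partial_deriv_eq:
  assumes "(f has_derivative D) (at x)"
  shows "partial_deriv i f x = D (axis i 1)"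
  using frechet_derivative_at[OF assms] by (simp add: partial_deriv_def)

lemma partial_derivs_append:
  "partial_derivs (is @ js) f = partial_derivs is (partial_derivs js f)"
  by (induction "is") auto

lemma smooth_partial_derivs: "smooth f \<Longrightarrow> smooth (partial_derivs is f)"
  unfolding smooth_def by (metis partial_derivs_append)

lemma smooth_partial_deriv: "smooth f \<Longrightarrow> smooth (partial_deriv i f)"
  using smooth_partial_derivs[of f "[i]"] by simp

lemma smooth_differentiable: "smooth f \<Longrightarrow> f differentiable at x"
  unfolding smooth_def by (metis partial_derivs.simps(1))

lemma smooth_continuous: "smooth f \<Longrightarrow> continuous_on A f"
  by (meson continuous_at_imp_continuous_on differentiable_imp_continuous_within smooth_differentiable)

lemma smooth_measurable: "smooth f \<Longrightarrow> f \<in> borel_measurable borel"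
  by (simp add: borel_measurable_continuous_onI smooth_continuous)

lemma differentiable_has_derivative_partials:
  fixes f :: "real ^ 'n::finite \<Rightarrow> 'b::real_normed_vector"
  assumes "f differentiable at x"
  shows "(f has_derivative (\<lambda>h. \<Sum>i\<in>UNIV. (h $ i) *\<^sub>R partial_deriv i f x)) (at x)"
proof -
  let ?D = "frechet_derivative f (at x)"
  have D: "(f has_derivative ?D) (at x)"
    using assms by (simp add: frechet_derivative_works)
  then interpret bounded_linear ?D by (rule has_derivative_bounded_linear)
  have "?D h = (\<Sum>i\<in>UNIV. (h $ i) *\<^sub>R partial_deriv i f x)" for h
  proof -
    have "?D h = ?D (\<Sum>i\<in>UNIV. (h $ i) *\<^sub>R axis i 1)"
      by (metis (no_types, lifting) basis_expansion scalar_mult_eq_scaleR sum.cong)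
    then show ?thesis by (simp add: sum scaleR partial_deriv_def)
  qed
  then have "?D = (\<lambda>h. \<Sum>i\<in>UNIV. (h $ i) *\<^sub>R partial_deriv i f x)" by (rule ext)
  with D show ?thesis by simp
qed

lemmas smooth_has_derivative =
  differentiable_has_derivative_partials[OF smooth_differentiable]

text \<open>Smoothness follows from a class of differentiable functions that is closed under partial
  derivatives. Exhibiting such a class avoids formulas for the iterated derivatives.\<close>

lemma smooth_coinduct:
  assumes "P f"
    and "\<And>f x. P f \<Longrightarrow> f differentiable at x"
    and "\<And>f i. P f \<Longrightarrow> P (partial_deriv i f)"
  shows "smooth f"
proof -
  have "P (partial_derivs is f)" for "is"
    by (induction "is") (auto intro: assms)
  then show ?thesis unfolding smooth_def using assms(2) by blast
qed

section \<open>Smooth functions under linear operations and affine substitutions\<close>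

lemma partial_deriv_add:
  assumes "f differentiable at x" "g differentiable at x"
  shows "partial_deriv i (\<lambda>x. f x + g x) x = partial_deriv i f x + partial_deriv i g x"
proof -
  have "((\<lambda>x. f x + g x) has_derivative
      (\<lambda>h. frechet_derivative f (at x) h + frechet_derivative g (at x) h)) (at x)"
    using assms by (auto intro!: has_derivative_add simp: frechet_derivative_works[symmetric])
  then show ?thesis by (simp add: partial_deriv_eq partial_deriv_def[of i f] partial_deriv_def[of i g])
qed

lemma partial_derivs_add:
  assumes "smooth f" "smooth g"
  shows "partial_derivs is (\<lambda>x. f x + g x) = (\<lambda>x. partial_derivs is f x + partial_derivs is g x)"
proof (induction "is")
  case (Cons i "is")
  have "partial_derivs is f differentiable at x" "partial_derivs is g differentiable at x" for x
    using assms by (auto simp: smooth_def)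
  then show ?case
    by (simp add: Cons.IH partial_deriv_add fun_eq_iff)
qed simp

lemma smooth_add: "smooth f \<Longrightarrow> smooth g \<Longrightarrow> smooth (\<lambda>x. f x + g x)"
  by (auto simp: smooth_def[of "\<lambda>x. f x + g x"] partial_derivs_add)
     (auto simp: smooth_def intro!: differentiable_add)

lemma partial_deriv_bounded_linear:
  assumes "bounded_linear L" "f differentiable at x"
  shows "partial_deriv i (\<lambda>x. L (f x)) x = L (partial_deriv i f x)"
proof -
  have "(f has_derivative frechet_derivative f (at x)) (at x)"
    using assms by (simp add: frechet_derivative_works)
  from bounded_linear.has_derivative[OF assms(1) this]
  show ?thesis by (simp add: partial_deriv_eq partial_deriv_def frechet_derivative_at[symmetric])
qed

lemma partial_derivs_bounded_linear:
  assumes "bounded_linear L" "smooth f"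
  shows "partial_derivs is (\<lambda>x. L (f x)) = (\<lambda>x. L (partial_derivs is f x))"
proof (induction "is")
  case (Cons i "is")
  have "partial_derivs is f differentiable at x" for x
    using assms by (auto simp: smooth_def)
  then show ?case
    by (simp add: Cons.IH partial_deriv_bounded_linear[OF assms(1)] fun_eq_iff)
qed simp

lemma differentiable_bounded_linear:
  assumes "bounded_linear L" "f differentiable at x"
  shows "(\<lambda>x. L (f x)) differentiable at x"
  using assms bounded_linear.has_derivative unfolding differentiable_def by blast

lemma smooth_bounded_linear:
  assumes "bounded_linear L" "smooth f"
  shows "smooth (\<lambda>x. L (f x))"
  using assms unfolding smooth_def[of "\<lambda>x. L (f x)"] partial_derivs_bounded_linear[OF assms]
  by (simp add: smooth_def differentiable_bounded_linear)

lemma partial_derivs_mult_left: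
  fixes f :: "real ^ 'n::finite \<Rightarrow> complex"
  shows "smooth f \<Longrightarrow> partial_derivs is (\<lambda>x. c * f x) = (\<lambda>x. c * partial_derivs is f x)"
  by (rule partial_derivs_bounded_linear[OF bounded_linear_mult_right])

lemma smooth_mult_left:
  fixes f :: "real ^ 'n::finite \<Rightarrow> complex"
  shows "smooth f \<Longrightarrow> smooth (\<lambda>x. c * f x)"
  by (rule smooth_bounded_linear[OF bounded_linear_mult_right])

lemma has_derivative_affine:
  fixes f :: "'a::real_normed_vector \<Rightarrow> 'b::real_normed_vector"
  assumes "(f has_derivative D) (at (c *\<^sub>R x + a))"
  shows "((\<lambda>x. f (c *\<^sub>R x + a)) has_derivative (\<lambda>h. D (c *\<^sub>R h))) (at x)"
proof -
  have "((\<lambda>x. c *\<^sub>R x + a) has_derivative (\<lambda>h. c *\<^sub>R h)) (at x)"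
    by (auto intro!: derivative_eq_intros)
  from has_derivative_compose[OF this assms] show ?thesis .
qed

lemma partial_derivs_affine:
  assumes "smooth f"
  shows "partial_derivs is (\<lambda>x. f (c *\<^sub>R x + a)) =
    (\<lambda>x. c ^ length is *\<^sub>R partial_derivs is f (c *\<^sub>R x + a))"
proof (induction "is")
  case (Cons i "is")
  let ?g = "partial_derivs is f"
  have "partial_deriv i (\<lambda>x. c ^ length is *\<^sub>R ?g (c *\<^sub>R x + a)) x =
      c ^ Suc (length is) *\<^sub>R partial_deriv i ?g (c *\<^sub>R x + a)" for x
  proof -
    let ?D = "frechet_derivative ?g (at (c *\<^sub>R x + a))"
    have D: "(?g has_derivative ?D) (at (c *\<^sub>R x + a))"
      using assms by (simp add: smooth_def frechet_derivative_works[symmetric])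
    have "((\<lambda>x. c ^ length is *\<^sub>R ?g (c *\<^sub>R x + a)) has_derivative
        (\<lambda>h. c ^ length is *\<^sub>R ?D (c *\<^sub>R h))) (at x)"
      by (intro has_derivative_scaleR_right has_derivative_affine D)
    from partial_deriv_eq[OF this] show ?thesis
      using linear_cmul[OF has_derivative_linear[OF D]] by (simp add: partial_deriv_def mult.commute)
  qed
  then show ?case by (simp add: Cons.IH fun_eq_iff)
qed simp

lemma smooth_affine:
  assumes "smooth f"
  shows "smooth (\<lambda>x. f (c *\<^sub>R x + a))"
  unfolding smooth_def partial_derivs_affine[OF assms]
proof (intro allI)
  fix "is" x
  have "(partial_derivs is f has_derivative frechet_derivative (partial_derivs is f) (at (c *\<^sub>R x + a)))
      (at (c *\<^sub>R x + a))"
    using assms by (simp add: smooth_def frechet_derivative_works[symmetric])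
  from has_derivative_scaleR_right[OF has_derivative_affine[OF this]]
  show "(\<lambda>x. c ^ length is *\<^sub>R partial_derivs is f (c *\<^sub>R x + a)) differentiable at x"
    unfolding differentiable_def by blast
qed

section \<open>Mean value and Taylor estimates from bounds on partial derivatives\<close>

lemma norm_sum_component_le:
  fixes v :: "'n::finite \<Rightarrow> 'b::real_normed_vector"
  assumes "\<And>i. norm (v i) \<le> M"
  shows "norm (\<Sum>i\<in>UNIV. (h $ i) *\<^sub>R v i) \<le> real CARD('n) * M * norm (h :: real ^ 'n)"
proof -
  have "norm (\<Sum>i\<in>UNIV. (h $ i) *\<^sub>R v i) \<le> (\<Sum>i\<in>(UNIV::'n set). norm h * M)"
    by (intro sum_norm_le) (use assms component_le_norm_cart[of h] in \<open>auto intro!: mult_mono\<close>)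
  then show ?thesis by (simp add: mult_ac)
qed

text \<open>The partials are bounded on the segment only, because the weighted estimate for
  translates below uses a bound \<open>M\<close> that depends on the endpoints.\<close>

lemma norm_diff_le_of_partials:
  fixes f :: "real ^ 'n::finite \<Rightarrow> 'b::real_normed_vector"
  assumes "smooth f" and "\<And>i z. z \<in> closed_segment a b \<Longrightarrow> norm (partial_deriv i f z) \<le> M"
  shows "norm (f a - f b) \<le> real CARD('n) * M * norm (a - b)"
proof (rule differentiable_bound[of "closed_segment a b"])
  fix x assume "x \<in> closed_segment a b"
  then show "onorm (\<lambda>h. \<Sum>i\<in>UNIV. (h $ i) *\<^sub>R partial_deriv i f x) \<le> real CARD('n) * M"
    by (intro onorm_le norm_sum_component_le assms)
qed (auto intro: has_derivative_at_withinI smooth_has_derivative[OF assms(1)])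

text \<open>The mean value inequality is used twice: the first partials vary by at most a multiple
  of \<open>norm h\<close> along the segment, and this variation bounds the derivative of
  \<open>f\<close> minus its linearisation at \<open>x\<close>. Each use contributes one factor
  \<open>CARD('n)\<close>.\<close>

lemma smooth_taylor_bound:
  fixes f :: "real ^ 'n::finite \<Rightarrow> 'b::real_normed_vector"
  assumes f: "smooth f" and M: "\<And>i j z. norm (partial_deriv j (partial_deriv i f) z) \<le> M"
  shows "norm (f (x + h) - f x - (\<Sum>i\<in>UNIV. (h $ i) *\<^sub>R partial_deriv i f x))
    \<le> real CARD('n) * (real CARD('n) * M) * (norm h)\<^sup>2"
proof -
  let ?n = "real CARD('n)"
  let ?D = "\<lambda>z h. \<Sum>i\<in>UNIV. (h $ i) *\<^sub>R partial_deriv i f z"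
  have "0 \<le> M" using M norm_ge_zero order_trans by blast
  have "norm (f (x + h) - f x - ?D x (x + h - x)) \<le> norm (x + h - x) * (?n * (?n * M * norm h))"
  proof (rule differentiable_bound_linearization[of x "x + h" "closed_segment x (x + h)"])
    fix z assume z: "z \<in> closed_segment x (x + h)"
    then have "norm (z - x) \<le> norm h"
      by (metis add_diff_cancel_left' norm_minus_commute segment_bound(1))
    then have "norm (partial_deriv i f z - partial_deriv i f x) \<le> ?n * M * norm h" for i
      using norm_diff_le_of_partials[OF smooth_partial_deriv[OF f, of i] M, of z x] \<open>0 \<le> M\<close>
      by (meson mult_left_mono mult_nonneg_nonneg of_nat_0_le_iff order_trans)
    then show "onorm (?D z - ?D x) \<le> ?n * (?n * M * norm h)"
      unfolding fun_diff_def sum_subtractf[symmetric] scaleR_diff_right[symmetric]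
      by (intro onorm_le norm_sum_component_le)
  next
    fix t :: real assume "t \<in> {0..1}"
    then show "x + t *\<^sub>R (x + h - x) \<in> closed_segment x (x + h)"
      by (auto simp: closed_segment_def algebra_simps)
  qed (auto intro: has_derivative_at_withinI smooth_has_derivative[OF f])
  then show ?thesis by (simp add: power2_eq_square mult_ac)
qed

lemma uniform_bound_finite:
  fixes F :: "'i::finite \<Rightarrow> 'j::finite \<Rightarrow> 'a \<Rightarrow> real"
  assumes "\<And>i j. \<exists>M. \<forall>z. F i j z \<le> M"
  obtains B where "\<And>i j z. F i j z \<le> B"
proof -
  have "\<forall>i j. \<exists>M. \<forall>z. F i j z \<le> M" using assms by blast
  then obtain M where M: "\<And>i j z. F i j z \<le> M i j" by metis
  have "M i j \<le> Max (range (\<lambda>(i, j). M i j))" for i j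
    by (rule Max_ge) (auto intro!: rev_image_eqI[of "(i, j)"])
  with M show ?thesis by (meson order_trans that)
qed

text \<open>Differentiation under the integral sign for integrands with a quadratic remainder whose
  coefficient is integrable: the remainder can be integrated directly, without a limit theorem. It
  serves frequencies in Fourier integrals, translations of the integrand, and convolutions.
  Restricting to \<open>norm h \<le> 1\<close> keeps translated supports inside a fixed
  ball.\<close>

lemma has_derivative_integral_partials:
  fixes K :: "'a \<Rightarrow> real ^ 'n::finite \<Rightarrow> 'b::{banach, second_countable_topology}"
  assumes K: "\<And>y. integrable M (\<lambda>x. K x y)"
    and D: "\<And>i. integrable M (D i)"
    and b: "integrable M b"
    and quad: "\<And>x h. norm h \<le> 1 \<Longrightarrow>
      norm (K x (y + h) - K x y - (\<Sum>i\<in>UNIV. (h $ i) *\<^sub>R D i x)) \<le> b x * (norm h)\<^sup>2"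
  shows "((\<lambda>y. LINT x|M. K x y) has_derivative (\<lambda>h. \<Sum>i\<in>UNIV. (h $ i) *\<^sub>R (LINT x|M. D i x))) (at y)"
proof -
  let ?F = "\<lambda>y. LINT x|M. K x y" and ?L = "\<lambda>h. \<Sum>i\<in>UNIV. (h $ i) *\<^sub>R (LINT x|M. D i x)"
  define B where "B = (LINT x|M. norm (b x))"
  have bl: "bounded_linear ?L"
    by (intro bounded_linear_sum bounded_linear_scaleR_const bounded_linear_vec_nth)
  have bound: "norm (?F (y + h) - ?F y - ?L h) \<le> B * (norm h)\<^sup>2" if "norm h \<le> 1" for h
  proof -
    have "?F (y + h) - ?F y - ?L h = (LINT x|M. K x (y + h) - K x y - (\<Sum>i\<in>UNIV. (h $ i) *\<^sub>R D i x))"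
      using K D by (simp add: integrable_scaleR_right)
    also have "norm \<dots> \<le> (LINT x|M. norm (b x) * (norm h)\<^sup>2)"
    proof (rule order_trans[OF integral_norm_bound integral_mono])
      fix x
      show "norm (K x (y + h) - K x y - (\<Sum>i\<in>UNIV. (h $ i) *\<^sub>R D i x)) \<le> norm (b x) * (norm h)\<^sup>2"
        by (rule order_trans[OF quad[OF that]]) (auto intro!: mult_right_mono)
    qed (use K D b in auto)
    finally show ?thesis by (simp add: B_def)
  qed
  have "((\<lambda>h. (?F (y + h) - ?F y - ?L h) /\<^sub>R norm h) \<longlongrightarrow> 0) (at 0)"
  proof (rule Lim_null_comparison)
    have "\<forall>\<^sub>F h in at (0::real ^ 'n). norm h < 1"
      using eventually_at_ball[of 1 "0::real ^ 'n" UNIV] by (auto elim!: eventually_mono)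
    then show "\<forall>\<^sub>F h in at 0. norm ((?F (y + h) - ?F y - ?L h) /\<^sub>R norm h) \<le> B * norm h"
    proof eventually_elim
      case (elim h)
      have "norm ((?F (y + h) - ?F y - ?L h) /\<^sub>R norm h) \<le> inverse (norm h) * (B * (norm h)\<^sup>2)"
        unfolding norm_scaleR using bound[of h] elim by (intro mult_mono) auto
      also have "\<dots> \<le> B * norm h"
        by (cases "h = 0") (auto simp: field_simps power2_eq_square)
      finally show ?case .
    qed
    show "((\<lambda>h. B * norm h) \<longlongrightarrow> 0) (at (0::real ^ 'n))"
      by (rule tendsto_eq_intros | simp)+
  qed
  from tendsto_norm_zero[OF this] bl show ?thesis
    by (simp add: has_derivative_at divide_inverse_commute)
qed

subsection \<open>Fourier transforms of test functions\<close>

text \<open>Compact support is expressed as vanishing outside a ball, a condition that passes to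
  derivatives and sums without handling closures of supports.\<close>

definition test_fun :: "(real ^ 'n::finite \<Rightarrow> complex) \<Rightarrow> bool" where
  "test_fun m \<longleftrightarrow> smooth m \<and> (\<exists>R. \<forall>x. R < norm x \<longrightarrow> m x = 0)"

lemma test_fun_partial_deriv:
  assumes "test_fun m"
  shows "test_fun (partial_deriv i m)"
proof -
  from assms obtain R where m: "smooth m" and R: "\<And>x. R < norm x \<Longrightarrow> m x = 0"
    by (auto simp: test_fun_def)
  have "partial_deriv i m x = 0" if "R < norm x" for x
  proof -
    have "(m has_derivative (\<lambda>h. 0)) (at x)"
      by (rule has_derivative_transform_within_open[of "\<lambda>x. 0" _ _ _ "- cball 0 R"]) (use that R in auto)
    then show ?thesis by (simp add: partial_deriv_eq)
  qed
  with m show ?thesis by (auto simp: test_fun_def smooth_partial_deriv)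
qed

lemma test_fun_add: "test_fun f \<Longrightarrow> test_fun g \<Longrightarrow> test_fun (\<lambda>x. f x + g x)"
proof -
  assume "test_fun f" "test_fun g"
  then obtain R S where "smooth f" "smooth g" "\<And>x. R < norm x \<Longrightarrow> f x = 0" "\<And>x. S < norm x \<Longrightarrow> g x = 0"
    by (auto simp: test_fun_def)
  then show ?thesis
    unfolding test_fun_def by (intro conjI exI[of _ "max R S"]) (auto simp: smooth_add)
qed

lemma test_fun_mult_left: "test_fun f \<Longrightarrow> test_fun (\<lambda>x. c * f x)"
  unfolding test_fun_def using smooth_mult_left by fastforce

text \<open>The shape \<open>x $ k * m1 x + m2 x\<close> is stable under partial derivatives:
  differentiating the coordinate leaves a constant multiple of \<open>m1\<close>, which joins the
  second summand. This takes the place of a Leibniz formula for mixed derivatives.\<close>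

lemma smooth_coord_mult:
  fixes m :: "real ^ 'n::finite \<Rightarrow> complex"
  assumes "smooth m"
  shows "smooth (\<lambda>x. complex_of_real (x $ k) * m x)"
proof -
  define P where "P f \<longleftrightarrow> (\<exists>m1 m2. smooth m1 \<and> smooth m2 \<and> f = (\<lambda>x. complex_of_real (x $ k) * m1 x + m2 x))"
    for f :: "real ^ 'n \<Rightarrow> complex"
  have D: "((\<lambda>x. complex_of_real (x $ k) * m1 x + m2 x) has_derivative
      (\<lambda>h. complex_of_real (x $ k) * frechet_derivative m1 (at x) h
        + complex_of_real (h $ k) * m1 x + frechet_derivative m2 (at x) h)) (at x)"
    if "smooth m1" "smooth m2" for m1 m2 :: "real ^ 'n \<Rightarrow> complex" and x
  proof -
    have "((\<lambda>x. complex_of_real (x $ k)) has_derivative (\<lambda>h. complex_of_real (h $ k))) (at x)"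
      by (intro bounded_linear_imp_has_derivative bounded_linear_compose[OF bounded_linear_of_real bounded_linear_vec_nth])
    moreover have "(m1 has_derivative frechet_derivative m1 (at x)) (at x)"
        "(m2 has_derivative frechet_derivative m2 (at x)) (at x)"
      using that by (simp_all add: smooth_differentiable frechet_derivative_works[symmetric])
    ultimately show ?thesis by (intro has_derivative_add has_derivative_mult)
  qed
  show ?thesis
  proof (rule smooth_coinduct[of P])
    show "P (\<lambda>x. complex_of_real (x $ k) * m x)"
      \<comment> \<open>The multiple by 0 supplies the smooth zero function as
        \<open>m2\<close>.\<close>
      unfolding P_def using assms smooth_mult_left[OF assms, of 0]
      by (intro exI[of _ m] exI[of _ "\<lambda>x. 0"]) auto
  next
    fix f x assume "P f"
    then show "f differentiable at x"
      unfolding P_def differentiable_def using D by blast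
  next
    fix f i assume "P f"
    then obtain m1 m2 where m: "smooth m1" "smooth m2" and f: "f = (\<lambda>x. complex_of_real (x $ k) * m1 x + m2 x)"
      by (auto simp: P_def)
    have "partial_deriv i f = (\<lambda>x. complex_of_real (x $ k) * partial_deriv i m1 x
        + (complex_of_real (axis i 1 $ k) * m1 x + partial_deriv i m2 x))"
      unfolding f by (rule ext, subst partial_deriv_eq[OF D[OF m]]) (simp add: partial_deriv_def)
    then show "P (partial_deriv i f)"
      unfolding P_def using m
      by (intro exI[of _ "partial_deriv i m1"]
            exI[of _ "\<lambda>x. complex_of_real (axis i 1 $ k) * m1 x + partial_deriv i m2 x"])
         (auto intro: smooth_add smooth_mult_left smooth_partial_deriv)
  qed
qed

lemma test_fun_coord_mult: "test_fun m \<Longrightarrow> test_fun (\<lambda>x. complex_of_real (x $ k) * m x)"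
  unfolding test_fun_def using smooth_coord_mult by fastforce

lemma continuous_compact_support_integrable:
  fixes m :: "'a::euclidean_space \<Rightarrow> 'b::{banach, second_countable_topology}"
  assumes "continuous_on UNIV m" "\<And>x. R < norm x \<Longrightarrow> m x = 0"
  shows "integrable lborel m"
proof -
  have "integrable lborel (\<lambda>x. indicator (cball 0 R) x *\<^sub>R m x)"
    using assms(1) by (intro borel_integrable_compact) (auto intro: continuous_on_subset)
  also have "(\<lambda>x. indicator (cball 0 R) x *\<^sub>R m x) = m"
    using assms(2) by (auto simp: indicator_def fun_eq_iff not_le)
  finally show ?thesis .
qed

lemma test_fun_integrable: "test_fun m \<Longrightarrow> integrable lborel m"
  unfolding test_fun_def by (metis continuous_compact_support_integrable smooth_continuous)

lemma test_fun_bounded: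
  assumes "test_fun m"
  obtains M where "0 \<le> M" "\<And>x. norm (m x) \<le> M"
proof -
  from assms obtain R where m: "smooth m" and R: "\<And>x. R < norm x \<Longrightarrow> m x = 0"
    by (auto simp: test_fun_def)
  have "bounded (m ` cball 0 R)"
    by (intro compact_imp_bounded compact_continuous_image smooth_continuous m compact_cball)
  then obtain M where M: "\<forall>z\<in>m ` cball 0 R. norm z \<le> M"
    unfolding bounded_iff by blast
  show ?thesis
  proof (rule that[of "max 0 M"])
    fix x show "norm (m x) \<le> max 0 M"
      using M R[of x] by (cases "norm x \<le> R") (auto simp: le_max_iff_disj)
  qed simp
qed

section \<open>The character exp(-i x.y) and Fourier integrals of test functions\<close>

abbreviation wave :: "real ^ 'n::finite \<Rightarrow> real ^ 'n \<Rightarrow> complex" where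
  "wave x y \<equiv> exp (- (\<i> * complex_of_real (x \<bullet> y)))"

lemma norm_wave [simp]: "norm (wave x y) = 1"
  using norm_exp_i_times[of "- (x \<bullet> y)"] by simp

lemma wave_measurable [measurable]: "(\<lambda>x. wave x y) \<in> borel_measurable borel"
  by (intro borel_measurable_continuous_onI continuous_intros)

lemma integrable_wave_mult:
  fixes m :: "real ^ 'n::finite \<Rightarrow> complex"
  assumes "integrable lborel m"
  shows "integrable lborel (\<lambda>x. wave x y * m x)"
proof (rule Bochner_Integration.integrable_bound[OF assms])
  have [measurable]: "m \<in> borel_measurable borel" using assms by auto
  show "(\<lambda>x. wave x y * m x) \<in> borel_measurable lborel" by measurable
qed (simp add: norm_mult)

lemma norm_fourier_le:
  "norm (fourier m y) \<le> (LINT x|lborel. norm (m x))"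
proof -
  have "norm (fourier m y) \<le> (LINT x|lborel. norm (wave x y * m x))"
    unfolding fourier_def by (rule integral_norm_bound)
  then show ?thesis by (simp add: norm_mult)
qed

text \<open>Second-order remainder of the exponential, followed by Cauchy-Schwarz. The growth in
  \<open>x\<close> is harmless because it will be multiplied by a compactly supported
  function.\<close>

lemma norm_wave_taylor: "norm (wave x h - 1 + \<i> * complex_of_real (x \<bullet> h)) \<le> (norm x)\<^sup>2 * (norm h)\<^sup>2"
proof -
  have "norm (wave x h - 1 + \<i> * complex_of_real (x \<bullet> h)) \<le> \<bar>x \<bullet> h\<bar>\<^sup>2 / 2"
    using iexp_approx1[of "- (x \<bullet> h)" 1] by (simp add: power2_eq_square algebra_simps)
  also have "\<dots> \<le> (norm x * norm h)\<^sup>2"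
    using power_mono[OF Cauchy_Schwarz_ineq2[of x h], of 2] zero_le_power2[of "norm x * norm h"]
    unfolding power2_abs by linarith
  finally show ?thesis by (simp add: power_mult_distrib)
qed

lemma fourier_test_fun_has_derivative:
  fixes m :: "real ^ 'n::finite \<Rightarrow> complex"
  assumes m: "test_fun m"
  shows "(fourier m has_derivative
    (\<lambda>h. \<Sum>i\<in>UNIV. (h $ i) *\<^sub>R fourier (\<lambda>x. - \<i> * (complex_of_real (x $ i) * m x)) y)) (at y)"
  unfolding fourier_def
proof (rule has_derivative_integral_partials)
  have m': "continuous_on UNIV m" using m by (auto simp: test_fun_def smooth_continuous)
  from m obtain R where R: "\<And>x. R < norm x \<Longrightarrow> m x = 0" by (auto simp: test_fun_def)
  show "integrable lborel (\<lambda>x. (norm x)\<^sup>2 * norm (m x))"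
    by (rule continuous_compact_support_integrable[where R = R]) (auto intro!: continuous_intros m' simp: R)
  show "integrable lborel (\<lambda>x. wave x y * m x)" for y
    by (intro integrable_wave_mult test_fun_integrable m)
  show "integrable lborel (\<lambda>x. wave x y * (- \<i> * (complex_of_real (x $ i) * m x)))" for i
    by (intro integrable_wave_mult test_fun_integrable test_fun_mult_left test_fun_coord_mult m)
next
  fix x h :: "real ^ 'n"
  have "(\<Sum>i\<in>UNIV. (h $ i) *\<^sub>R (wave x y * (- \<i> * (complex_of_real (x $ i) * m x))))
      = - \<i> * wave x y * m x * complex_of_real (\<Sum>i\<in>UNIV. x $ i * h $ i)"
    by (simp add: sum_distrib_left scaleR_conv_of_real mult_ac sum_negf)
  also have "(\<Sum>i\<in>UNIV. x $ i * h $ i) = x \<bullet> h" by (simp add: inner_vec_def)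
  finally have sum_eq: "(\<Sum>i\<in>UNIV. (h $ i) *\<^sub>R (wave x y * (- \<i> * (complex_of_real (x $ i) * m x))))
      = - \<i> * wave x y * m x * complex_of_real (x \<bullet> h)" .
  \<comment> \<open>By multiplicativity the expansion at \<open>y\<close> reduces to the one at
    frequency 0, up to a factor of modulus 1.\<close>
  have wave_add: "wave x (y + h) = wave x y * wave x h"
    by (simp add: inner_add_right algebra_simps exp_add[symmetric])
  have "wave x (y + h) * m x - wave x y * m x
      - (\<Sum>i\<in>UNIV. (h $ i) *\<^sub>R (wave x y * (- \<i> * (complex_of_real (x $ i) * m x))))
    = wave x y * m x * (wave x h - 1 + \<i> * complex_of_real (x \<bullet> h))"
    unfolding sum_eq wave_add by (simp add: algebra_simps)
  then show "norm (wave x (y + h) * m x - wave x y * m x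
      - (\<Sum>i\<in>UNIV. (h $ i) *\<^sub>R (wave x y * (- \<i> * (complex_of_real (x $ i) * m x)))))
    \<le> (norm x)\<^sup>2 * norm (m x) * (norm h)\<^sup>2"
    using mult_left_mono[OF norm_wave_taylor[of x h] norm_ge_zero[of "m x"]]
    by (simp add: norm_mult mult_ac)
qed

lemma fourier_translate:
  fixes m :: "real ^ 'n::finite \<Rightarrow> complex"
  assumes "m \<in> borel_measurable borel"
  shows "(LINT x|lborel. wave x y * m (x + h)) = exp (\<i> * complex_of_real (h \<bullet> y)) * fourier m y"
proof -
  have [measurable]: "m \<in> borel_measurable borel" by fact
  have "fourier m y = (LINT x|distr lborel borel ((+) h). wave x y * m x)"
    unfolding fourier_def by (simp add: lborel_distr_plus)
  also have "\<dots> = (LINT x|lborel. wave (h + x) y * m (h + x))"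
    by (rule integral_distr) auto
  also have "(\<lambda>x. wave (h + x) y * m (h + x)) = (\<lambda>x. wave h y * (wave x y * m (x + h)))"
    by (simp add: fun_eq_iff inner_add_left exp_add[symmetric] algebra_simps)
  also have "(LINT x|lborel. wave h y * (wave x y * m (x + h))) = wave h y * (LINT x|lborel. wave x y * m (x + h))"
    by (rule integral_mult_right_zero)
  finally have "exp (\<i> * complex_of_real (h \<bullet> y)) * fourier m y =
      exp (\<i> * complex_of_real (h \<bullet> y)) * wave h y * (LINT x|lborel. wave x y * m (x + h))"
    by (simp only: mult.assoc)
  moreover have "exp (\<i> * complex_of_real (h \<bullet> y)) * wave h y = 1"
    unfolding exp_add[symmetric] by simp
  ultimately show ?thesis by (simp only: mult_1_left)
qed

text \<open>Obtained by differentiating the translation rule at $h = 0$, which avoids integration by parts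
  in several variables.\<close>

lemma fourier_partial_deriv:
  fixes m :: "real ^ 'n::finite \<Rightarrow> complex"
  assumes m: "test_fun m"
  shows "fourier (partial_deriv k m) y = \<i> * complex_of_real (y $ k) * fourier m y"
proof -
  from m obtain R where m': "smooth m" and R: "\<And>x. R < norm x \<Longrightarrow> m x = 0" by (auto simp: test_fun_def)
  have "\<exists>M. \<forall>z. norm (partial_deriv j (partial_deriv i m) z) \<le> M" for i j
    using test_fun_bounded[OF test_fun_partial_deriv[OF test_fun_partial_deriv[OF m]]] by metis
  then obtain B where B: "\<And>i j z. norm (partial_deriv j (partial_deriv i m) z) \<le> B"
    by (rule uniform_bound_finite[where F = "\<lambda>i j z. norm (partial_deriv j (partial_deriv i m) z)"]) (rule that)
  define C where "C = real CARD('n) * (real CARD('n) * B)"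
  have "((\<lambda>h. LINT x|lborel. wave x y * m (x + h)) has_derivative
      (\<lambda>h. \<Sum>i\<in>UNIV. (h $ i) *\<^sub>R (LINT x|lborel. wave x y * partial_deriv i m x))) (at 0)"
  proof (rule has_derivative_integral_partials)
    \<comment> \<open>The radius grows by one because shifts of length at most one are compared:
      outside this ball both \<open>m x\<close> and \<open>m (x + h)\<close> vanish.\<close>
    show "integrable lborel (\<lambda>x. C * indicator (cball 0 (R + 1)) x)"
      by (intro integrable_mult_right integrable_real_indicator emeasure_lborel_cball_finite) auto
    show "integrable lborel (\<lambda>x. wave x y * m (x + h))" for h
    proof (intro integrable_wave_mult continuous_compact_support_integrable)
      show "continuous_on UNIV (\<lambda>x. m (x + h))"
        by (rule continuous_on_compose2[OF smooth_continuous[OF m', of UNIV]]) (auto intro!: continuous_intros)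
      show "m (x + h) = 0" if "R + norm h < norm x" for x
        using that norm_diff_ineq[of x h] by (intro R) linarith
    qed
    show "integrable lborel (\<lambda>x. wave x y * partial_deriv i m x)" for i
      by (intro integrable_wave_mult test_fun_integrable test_fun_partial_deriv m)
  next
    fix x h :: "real ^ 'n" assume h: "norm h \<le> 1"
    have eq: "wave x y * m (x + (0 + h)) - wave x y * m (x + 0)
        - (\<Sum>i\<in>UNIV. (h $ i) *\<^sub>R (wave x y * partial_deriv i m x))
      = wave x y * (m (x + h) - m x - (\<Sum>i\<in>UNIV. (h $ i) *\<^sub>R partial_deriv i m x))"
      by (simp add: algebra_simps sum_distrib_left)
    show "norm (wave x y * m (x + (0 + h)) - wave x y * m (x + 0)
        - (\<Sum>i\<in>UNIV. (h $ i) *\<^sub>R (wave x y * partial_deriv i m x)))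
      \<le> C * indicator (cball 0 (R + 1)) x * (norm h)\<^sup>2"
    proof (cases "norm x \<le> R + 1")
      case True
      then show ?thesis unfolding eq
        using smooth_taylor_bound[OF m' B, of x h] by (simp add: norm_mult C_def)
    next
      case False
      have "m x = 0" "m (x + h) = 0"
        using False h norm_diff_ineq[of x h] by (auto intro!: R)
      moreover have "partial_deriv i m x = 0" for i
      proof -
        have "(m has_derivative (\<lambda>h. 0)) (at x)"
          by (rule has_derivative_transform_within_open[of "\<lambda>x. 0" _ _ _ "- cball 0 R"]) (use False R in auto)
        then show ?thesis by (simp add: partial_deriv_eq)
      qed
      ultimately show ?thesis unfolding eq using False by simp
    qed
  qed
  \<comment> \<open>The same function of \<open>h\<close> is a character times a constant, so its
    derivative at 0 has a second expression. Evaluating both at \<open>axis k 1\<close> isolates the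
    k-th partial derivative.\<close>
  moreover have "((\<lambda>h. LINT x|lborel. wave x y * m (x + h)) has_derivative
      (\<lambda>h. \<i> * complex_of_real (h \<bullet> y) * fourier m y)) (at 0)"
  proof -
    have "((\<lambda>h. \<i> * complex_of_real (h \<bullet> y)) has_derivative (\<lambda>h. \<i> * complex_of_real (h \<bullet> y))) (at 0)"
      by (intro bounded_linear_imp_has_derivative bounded_linear_const_mult
          bounded_linear_compose[OF bounded_linear_of_real bounded_linear_inner_left])
    from has_derivative_mult_left[OF has_derivative_compose[OF this has_field_derivative_imp_has_derivative[OF DERIV_exp]]]
    have "((\<lambda>h. exp (\<i> * complex_of_real (h \<bullet> y)) * fourier m y) has_derivative
        (\<lambda>h. exp (\<i> * complex_of_real (0 \<bullet> y)) * (\<i> * complex_of_real (h \<bullet> y)) * fourier m y)) (at 0)" .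
    then show ?thesis using smooth_measurable[OF m'] by (simp add: fourier_translate)
  qed
  ultimately have "(\<lambda>h. \<Sum>i\<in>UNIV. (h $ i) *\<^sub>R (LINT x|lborel. wave x y * partial_deriv i m x))
      = (\<lambda>h. \<i> * complex_of_real (h \<bullet> y) * fourier m y)"
    by (rule has_derivative_unique)
  then have "(\<Sum>i\<in>UNIV. (axis k 1 $ i) *\<^sub>R (LINT x|lborel. wave x y * partial_deriv i m x))
      = \<i> * complex_of_real (axis k 1 \<bullet> y) * fourier m y"
    by (rule fun_cong)
  moreover have "(\<Sum>i\<in>UNIV. (axis k 1 $ i) *\<^sub>R (LINT x|lborel. wave x y * partial_deriv i m x))
      = (LINT x|lborel. wave x y * partial_deriv k m x)"
    by (subst sum.remove[of _ k]) (auto simp: axis_def intro!: sum.neutral)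
  moreover have "axis k 1 \<bullet> y = y $ k"
    by (simp add: inner_axis' )
  ultimately show ?thesis by (simp add: fourier_def)
qed

section \<open>Fourier transforms of test functions are Schwartz functions\<close>

lemma schwartz_iff:
  "schwartz f \<longleftrightarrow> smooth f \<and> (\<forall>k is. \<exists>C. \<forall>x. (1 + norm x) ^ k * norm (partial_derivs is f x) \<le> C)"
  by (auto simp: schwartz_def bdd_above_def)

text \<open>A power of \<open>norm y\<close> is traded for one derivative:
  \<open>\<bar>y $ i\<bar>\<close> times the transform of \<open>m\<close> is, in modulus, the
  transform of a partial derivative, which is again a test function. Hence the induction has
  \<open>m\<close> arbitrary and starts from the bound by the integral of
  \<open>norm (m x)\<close>.\<close>

lemma fourier_test_fun_decay:
  fixes m :: "real ^ 'n::finite \<Rightarrow> complex"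
  assumes "test_fun m"
  shows "\<exists>C. \<forall>y. (1 + norm y) ^ k * norm (fourier m y) \<le> C"
  using assms
proof (induction k arbitrary: m)
  case 0
  then show ?case using norm_fourier_le by auto
next
  case (Suc k)
  obtain C0 where C0: "\<And>y. (1 + norm y) ^ k * norm (fourier m y) \<le> C0" using Suc by blast
  have "\<exists>C. \<forall>y. (1 + norm y) ^ k * norm (fourier (partial_deriv i m) y) \<le> C" for i
    using Suc test_fun_partial_deriv by blast
  then obtain C where C: "\<And>i y. (1 + norm y) ^ k * norm (fourier (partial_deriv i m) y) \<le> C i" by metis
  have "(1 + norm y) ^ Suc k * norm (fourier m y) \<le> C0 + (\<Sum>i\<in>UNIV. C i)" for y
  proof -
    have "norm y * norm (fourier m y) \<le> (\<Sum>i\<in>UNIV. \<bar>y $ i\<bar>) * norm (fourier m y)"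
      by (intro mult_right_mono norm_le_l1_cart) auto
    also have "\<dots> = (\<Sum>i\<in>UNIV. norm (fourier (partial_deriv i m) y))"
      by (simp add: fourier_partial_deriv[OF Suc.prems] sum_distrib_right norm_mult)
    finally have "(1 + norm y) ^ k * (norm y * norm (fourier m y))
        \<le> (1 + norm y) ^ k * (\<Sum>i\<in>UNIV. norm (fourier (partial_deriv i m) y))"
      by (intro mult_left_mono) auto
    also have "\<dots> \<le> (\<Sum>i\<in>UNIV. C i)"
      unfolding sum_distrib_left by (intro sum_mono C)
    finally show ?thesis using C0[of y] by (simp add: algebra_simps)
  qed
  then show ?case by blast
qed

text \<open>Differentiating the transform multiplies the test function by a coordinate, so
  transforms of test functions form a class closed under partial derivatives. Decay of all
  derivatives is then decay of members of this class.\<close>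

lemma schwartz_fourier_test_fun:
  fixes m :: "real ^ 'n::finite \<Rightarrow> complex"
  assumes "test_fun m"
  shows "schwartz (fourier m)"
proof -
  define P where "P f \<longleftrightarrow> (\<exists>m. test_fun m \<and> f = fourier m)" for f :: "real ^ 'n \<Rightarrow> complex"
  have P: "P (partial_deriv i f)" if "P f" for f i
  proof -
    from that obtain m where m: "test_fun m" "f = fourier m" by (auto simp: P_def)
    have "partial_deriv i f y = fourier (\<lambda>x. - \<i> * (complex_of_real (x $ i) * m x)) y" for y
      unfolding m(2) partial_deriv_eq[OF fourier_test_fun_has_derivative[OF m(1)]]
      by (subst sum.remove[of _ i]) (auto simp: axis_def intro!: sum.neutral)
    then have "partial_deriv i f = fourier (\<lambda>x. - \<i> * (complex_of_real (x $ i) * m x))" by (rule ext)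
    with test_fun_mult_left[OF test_fun_coord_mult[OF m(1)], of "- \<i>" i] show ?thesis
      unfolding P_def by blast
  qed
  have "P (partial_derivs is (fourier m))" for "is"
    by (induction "is") (use assms P in \<open>auto simp: P_def\<close>)
  moreover have "smooth (fourier m)"
  proof (rule smooth_coinduct[of P])
    show "P (fourier m)" using assms by (auto simp: P_def)
    show "f differentiable at x" if "P f" for f x
      using that fourier_test_fun_has_derivative unfolding P_def differentiable_def by blast
  qed (rule P)
  ultimately show ?thesis
    unfolding schwartz_iff using fourier_test_fun_decay unfolding P_def by metis
qed

subsection \<open>Pairing a tempered distribution with translates of a Schwartz function\<close>

lemma schwartzD:
  assumes "schwartz f"
  obtains C where "0 \<le> C" "\<And>x. (1 + norm x) ^ k * norm (partial_derivs is f x) \<le> C"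
proof -
  from assms obtain C where C: "\<And>x. (1 + norm x) ^ k * norm (partial_derivs is f x) \<le> C"
    unfolding schwartz_iff by blast
  moreover have "0 \<le> (1 + norm (0::real^'a)) ^ k * norm (partial_derivs is f 0)" by simp
  ultimately show ?thesis using that[of C] order_trans by blast
qed

lemma schwartz_smooth: "schwartz f \<Longrightarrow> smooth f"
  by (simp add: schwartz_def)

lemma schwartz_partial_deriv:
  assumes "schwartz f"
  shows "schwartz (partial_deriv i f)"
proof -
  have "partial_derivs is (partial_deriv i f) = partial_derivs (is @ [i]) f" for "is"
    by (simp add: partial_derivs_append)
  then show ?thesis
    using assms smooth_partial_deriv unfolding schwartz_iff by metis
qed

lemma partial_derivs_lincomb:
  fixes f g :: "real ^ 'n::finite \<Rightarrow> complex"
  assumes "smooth f" "smooth g"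
  shows "partial_derivs is (\<lambda>x. a * f x + b * g x) = (\<lambda>x. a * partial_derivs is f x + b * partial_derivs is g x)"
  using assms by (simp add: partial_derivs_add smooth_mult_left partial_derivs_mult_left)

lemma schwartz_lincomb:
  assumes "schwartz f" "schwartz g"
  shows "schwartz (\<lambda>x. a * f x + b * g x)"
  unfolding schwartz_iff
proof (intro conjI allI)
  show "smooth (\<lambda>x. a * f x + b * g x)"
    using assms by (intro smooth_add smooth_mult_left schwartz_smooth)
  fix k "is"
  obtain C where C: "\<And>x. (1 + norm x) ^ k * norm (partial_derivs is f x) \<le> C"
    using schwartzD[OF assms(1)] by metis
  obtain D where D: "\<And>x. (1 + norm x) ^ k * norm (partial_derivs is g x) \<le> D"
    using schwartzD[OF assms(2)] by metis
  have "(1 + norm x) ^ k * norm (partial_derivs is (\<lambda>x. a * f x + b * g x) x) \<le> norm a * C + norm b * D" for x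
  proof -
    have "norm (partial_derivs is (\<lambda>x. a * f x + b * g x) x)
        \<le> norm a * norm (partial_derivs is f x) + norm b * norm (partial_derivs is g x)"
      using assms by (simp add: partial_derivs_lincomb schwartz_smooth norm_mult[symmetric] norm_triangle_ineq)
    then have "(1 + norm x) ^ k * norm (partial_derivs is (\<lambda>x. a * f x + b * g x) x)
        \<le> (1 + norm x) ^ k * (norm a * norm (partial_derivs is f x) + norm b * norm (partial_derivs is g x))"
      by (intro mult_left_mono) auto
    also have "\<dots> = norm a * ((1 + norm x) ^ k * norm (partial_derivs is f x))
        + norm b * ((1 + norm x) ^ k * norm (partial_derivs is g x))"
      by (simp add: algebra_simps)
    also have "\<dots> \<le> norm a * C + norm b * D"
      by (intro add_mono mult_left_mono C D) auto
    finally show ?thesis .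
  qed
  then show "\<exists>C. \<forall>x. (1 + norm x) ^ k * norm (partial_derivs is (\<lambda>x. a * f x + b * g x) x) \<le> C"
    by blast
qed

lemma partial_derivs_translate:
  assumes "smooth f"
  shows "partial_derivs is (\<lambda>y. f (y - a)) = (\<lambda>y. partial_derivs is f (y - a))"
  using partial_derivs_affine[OF assms, of "is" 1 "- a"] by simp

lemma smooth_translate: "smooth f \<Longrightarrow> smooth (\<lambda>y. f (y - a))"
  using smooth_affine[of f 1 "- a"] by simp

text \<open>Peetre's inequality: moving the polynomial weight to a translated point costs only a
  power of the translation.\<close>

lemma weight_shift:
  "(1 + norm (y::'a::real_normed_vector)) ^ k \<le> (1 + norm (y - a)) ^ k * (1 + norm a) ^ k"
proof -
  have "1 + norm y \<le> 1 + (norm (y - a) + norm a)"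
    using norm_triangle_sub[of y a] by simp
  also have "\<dots> \<le> (1 + norm (y - a)) * (1 + norm a)"
    by (simp add: algebra_simps)
  finally show ?thesis by (simp add: power_mono power_mult_distrib[symmetric])
qed

lemma schwartz_translate:
  assumes "schwartz f"
  shows "schwartz (\<lambda>y. f (y - a))"
  unfolding schwartz_iff
proof (intro conjI allI)
  show "smooth (\<lambda>y. f (y - a))" using assms by (intro smooth_translate schwartz_smooth)
  fix k "is"
  obtain C where C: "\<And>x. (1 + norm x) ^ k * norm (partial_derivs is f x) \<le> C"
    using schwartzD[OF assms] by metis
  have "(1 + norm x) ^ k * norm (partial_derivs is (\<lambda>y. f (y - a)) x) \<le> (1 + norm a) ^ k * C" for x
  proof -
    have "(1 + norm x) ^ k * norm (partial_derivs is f (x - a))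
        \<le> (1 + norm (x - a)) ^ k * (1 + norm a) ^ k * norm (partial_derivs is f (x - a))"
      by (intro mult_right_mono weight_shift) auto
    also have "\<dots> \<le> (1 + norm a) ^ k * C"
      using mult_left_mono[OF C[of "x - a"], of "(1 + norm a) ^ k"] by (simp add: mult_ac)
    finally show ?thesis by (simp add: partial_derivs_translate schwartz_smooth assms)
  qed
  then show "\<exists>C. \<forall>x. (1 + norm x) ^ k * norm (partial_derivs is (\<lambda>y. f (y - a)) x) \<le> C" by blast
qed

section \<open>Linearity, finite order and behaviour under translation\<close>

lemma tempered_linear:
  "tempered u \<Longrightarrow> schwartz \<phi> \<Longrightarrow> schwartz \<eta> \<Longrightarrow> u (\<lambda>x. a * \<phi> x + b * \<eta> x) = a * u \<phi> + b * u \<eta>"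
  by (simp add: tempered_def)

text \<open>Condenses the finite sum of seminorms into one order \<open>N\<close> and one common
  pointwise bound \<open>B\<close>: the weight of order \<open>N\<close> dominates the lower ones,
  and the number of summands goes into the constant. Later estimates are thus free of
  suprema.\<close>

lemma tempered_bound:
  fixes u :: "'n::finite distr"
  assumes "tempered u"
  obtains C N where "0 \<le> C"
    "\<And>\<phi> B. schwartz \<phi> \<Longrightarrow>
      (\<And>is x. length is \<le> N \<Longrightarrow> (1 + norm x) ^ N * norm (partial_derivs is \<phi> x) \<le> B) \<Longrightarrow>
      norm (u \<phi>) \<le> C * B"
proof -
  from assms obtain C N where u: "\<And>\<phi>. schwartz \<phi> \<Longrightarrow>
      norm (u \<phi>) \<le> C * (\<Sum>k\<le>N. \<Sum>is | length is \<le> N. schwartz_seminorm k is \<phi>)"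
    unfolding tempered_def by blast
  define K where "K = real (card {is :: 'n list. length is \<le> N})"
  have "norm (u \<phi>) \<le> (\<bar>C\<bar> * (real (Suc N) * K)) * B"
    if \<phi>: "schwartz \<phi>" and B: "\<And>is x. length is \<le> N \<Longrightarrow> (1 + norm x) ^ N * norm (partial_derivs is \<phi> x) \<le> B"
    for \<phi> B
  proof -
    have le: "schwartz_seminorm k is \<phi> \<le> B" if "k \<le> N" "length is \<le> N" for k "is"
      unfolding schwartz_seminorm_def
    proof (rule cSUP_least)
      fix x
      have "(1 + norm x) ^ k * norm (partial_derivs is \<phi> x) \<le> (1 + norm x) ^ N * norm (partial_derivs is \<phi> x)"
        using that by (intro mult_right_mono power_increasing) auto
      then show "(1 + norm x) ^ k * norm (partial_derivs is \<phi> x) \<le> B"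
        using B[OF that(2), of x] by simp
    qed simp
    have "0 \<le> (1 + norm (0 :: real ^ 'n)) ^ N * norm (partial_derivs [] \<phi> 0)" by simp
    then have "0 \<le> B" using order_trans[OF _ B[of "[]" 0]] by simp
    have nn: "0 \<le> schwartz_seminorm k is \<phi>" for k "is"
    proof -
      have "0 \<le> (1 + norm (0 :: real ^ 'n)) ^ k * norm (partial_derivs is \<phi> 0)" by simp
      also have "\<dots> \<le> schwartz_seminorm k is \<phi>"
        unfolding schwartz_seminorm_def using \<phi> by (intro cSUP_upper) (auto simp: schwartz_def)
      finally show ?thesis .
    qed
    have "norm (u \<phi>) \<le> C * (\<Sum>k\<le>N. \<Sum>is | length is \<le> N. schwartz_seminorm k is \<phi>)"
      by (rule u[OF \<phi>])
    \<comment> \<open>The definition of \<open>tempered\<close> does not fix the sign of its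
      constant, while monotonicity needs a nonnegative factor.\<close>
    also have "\<dots> \<le> \<bar>C\<bar> * (\<Sum>k\<le>N. \<Sum>is | length is \<le> N. schwartz_seminorm k is \<phi>)"
      by (intro mult_right_mono sum_nonneg nn) auto
    also have "\<dots> \<le> \<bar>C\<bar> * (\<Sum>k\<le>N. \<Sum>is :: 'n list | length is \<le> N. B)"
      by (intro mult_left_mono sum_mono le) auto
    finally show ?thesis by (simp add: K_def mult_ac)
  qed
  then show ?thesis by (intro that[of "\<bar>C\<bar> * (real (Suc N) * K)" N]) (auto simp: K_def)
qed

lemma tempered_sum:
  fixes u :: "'n::finite distr"
  assumes u: "tempered u" and F: "finite F" and \<phi>: "\<And>z. z \<in> F \<Longrightarrow> schwartz (\<phi> z)"
  shows "schwartz (\<lambda>y. \<Sum>z\<in>F. c z * \<phi> z y)"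
    and "u (\<lambda>y. \<Sum>z\<in>F. c z * \<phi> z y) = (\<Sum>z\<in>F. c z * u (\<phi> z))"
    and "partial_derivs is (\<lambda>y. \<Sum>z\<in>F. c z * \<phi> z y) = (\<lambda>y. \<Sum>z\<in>F. c z * partial_derivs is (\<phi> z) y)"
proof -
  have "schwartz (\<lambda>y. \<Sum>z\<in>F. c z * \<phi> z y)
    \<and> u (\<lambda>y. \<Sum>z\<in>F. c z * \<phi> z y) = (\<Sum>z\<in>F. c z * u (\<phi> z))
    \<and> partial_derivs is (\<lambda>y. \<Sum>z\<in>F. c z * \<phi> z y) = (\<lambda>y. \<Sum>z\<in>F. c z * partial_derivs is (\<phi> z) y)"
    using F \<phi>
  proof (induction F)
    case empty
    have s0: "smooth (\<lambda>y :: real ^ 'n. 0 :: complex)"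
      by (rule smooth_coinduct[of "\<lambda>f. f = (\<lambda>y. 0)"]) (auto simp: partial_deriv_def)
    have d0: "partial_derivs is (\<lambda>y :: real ^ 'n. 0 :: complex) = (\<lambda>y. 0)" for "is"
      by (induction "is") (auto simp: partial_deriv_def)
    have "schwartz (\<lambda>y :: real ^ 'n. 0 :: complex)" by (simp add: schwartz_def s0 d0)
    then show ?case using tempered_linear[OF u, of "\<lambda>y. 0" "\<lambda>y. 0" 0 0] by (simp add: d0)
  next
    case (insert w F)
    then have IH: "schwartz (\<lambda>y. \<Sum>z\<in>F. c z * \<phi> z y)"
        "u (\<lambda>y. \<Sum>z\<in>F. c z * \<phi> z y) = (\<Sum>z\<in>F. c z * u (\<phi> z))"
        "partial_derivs is (\<lambda>y. \<Sum>z\<in>F. c z * \<phi> z y) = (\<lambda>y. \<Sum>z\<in>F. c z * partial_derivs is (\<phi> z) y)"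
      and w: "schwartz (\<phi> w)" by auto
    have eq: "(\<lambda>y. \<Sum>z\<in>insert w F. c z * \<phi> z y) = (\<lambda>y. c w * \<phi> w y + 1 * (\<Sum>z\<in>F. c z * \<phi> z y))"
      using insert by simp
    show ?case
      unfolding eq
      using insert(1,2) tempered_linear[OF u w IH(1), of "c w" 1] schwartz_lincomb[OF w IH(1), of "c w" 1]
        partial_derivs_lincomb[OF schwartz_smooth[OF w] schwartz_smooth[OF IH(1)], of "is" "c w" 1]
      by (simp add: IH(2,3))
  qed
  then show "schwartz (\<lambda>y. \<Sum>z\<in>F. c z * \<phi> z y)"
    and "u (\<lambda>y. \<Sum>z\<in>F. c z * \<phi> z y) = (\<Sum>z\<in>F. c z * u (\<phi> z))"
    and "partial_derivs is (\<lambda>y. \<Sum>z\<in>F. c z * \<phi> z y) = (\<lambda>y. \<Sum>z\<in>F. c z * partial_derivs is (\<phi> z) y)"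
    by auto
qed

text \<open>Uniformly in \<open>y\<close>, translates grow polynomially and depend in a locally
  Lipschitz way on the translation, in exactly the norms controlling a distribution of order
  \<open>N\<close>. The second bound is the mean value inequality between \<open>y - a\<close> and
  \<open>y - b\<close>, with the weight carried along by Peetre's inequality.\<close>

lemma schwartz_translate_bounds:
  fixes G :: "real ^ 'n::finite \<Rightarrow> complex"
  assumes G: "schwartz G"
  obtains M where "0 \<le> M"
    "\<And>is a y. length is \<le> N \<Longrightarrow> (1 + norm y) ^ N * norm (partial_derivs is G (y - a)) \<le> M * (1 + norm a) ^ N"
    "\<And>is a b y. length is \<le> N \<Longrightarrow>
      (1 + norm y) ^ N * norm (partial_derivs is G (y - a) - partial_derivs is G (y - b))
        \<le> M * norm (a - b) * (1 + norm a + norm b) ^ N"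
proof -
  have "\<forall>is. \<exists>C\<ge>0. \<forall>x. (1 + norm x) ^ N * norm (partial_derivs is G x) \<le> C"
    using schwartzD[OF G] by metis
  then obtain C where C0: "\<And>is. 0 \<le> C is"
    and C: "\<And>is x. (1 + norm x) ^ N * norm (partial_derivs is G x) \<le> C is" by metis
  \<comment> \<open>One derivative beyond \<open>N\<close> is reserved for the mean value
    inequality.\<close>
  define S where "S = {is :: 'n list. length is \<le> Suc N}"
  have "finite S"
    using finite_lists_length_le[of "UNIV :: 'n set" "Suc N"] by (simp add: S_def)
  define M where "M = (\<Sum>is\<in>S. C is)"
  have "0 \<le> M" by (simp add: M_def C0 sum_nonneg)
  have M: "(1 + norm x) ^ N * norm (partial_derivs is G x) \<le> M" if "length is \<le> Suc N" for "is" x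
  proof -
    have "C is \<le> M"
      unfolding M_def using that \<open>finite S\<close> by (intro member_le_sum) (auto simp: S_def C0)
    then show ?thesis using C order_trans by blast
  qed
  show ?thesis
  proof (rule that[of "M + real CARD('n) * M"])
    show "0 \<le> M + real CARD('n) * M" using \<open>0 \<le> M\<close> by simp
    fix "is" :: "'n list" and a y :: "real ^ 'n" assume len: "length is \<le> N"
    have "(1 + norm y) ^ N * norm (partial_derivs is G (y - a))
        \<le> (1 + norm (y - a)) ^ N * (1 + norm a) ^ N * norm (partial_derivs is G (y - a))"
      by (intro mult_right_mono weight_shift) auto
    also have "\<dots> \<le> M * (1 + norm a) ^ N"
      using mult_right_mono[OF M[of "is" "y - a"], of "(1 + norm a) ^ N"] len by (simp add: mult_ac)
    also have "\<dots> \<le> (M + real CARD('n) * M) * (1 + norm a) ^ N"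
      using \<open>0 \<le> M\<close> by (intro mult_right_mono) auto
    finally show "(1 + norm y) ^ N * norm (partial_derivs is G (y - a)) \<le> (M + real CARD('n) * M) * (1 + norm a) ^ N" .
  next
    fix "is" :: "'n list" and a b y :: "real ^ 'n" assume len: "length is \<le> N"
    let ?H = "partial_derivs is G" and ?W = "(1 + norm a + norm b) ^ N"
    have H: "smooth ?H" by (intro smooth_partial_derivs schwartz_smooth G)
    \<comment> \<open>The mean value inequality needs a bound that is constant along the segment.
      Since \<open>y - z\<close> is a convex combination of \<open>a\<close> and \<open>b\<close>,
      the weight at \<open>z\<close> can be exchanged for the weight at \<open>y\<close> at the cost
      of \<open>?W\<close>.\<close>
    have "norm (partial_deriv i ?H z) \<le> M * ?W / (1 + norm y) ^ N"
      if z: "z \<in> closed_segment (y - a) (y - b)" for i z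
    proof -
      from z obtain t where t: "0 \<le> t" "t \<le> 1" and z: "z = (1 - t) *\<^sub>R (y - a) + t *\<^sub>R (y - b)"
        by (auto simp: closed_segment_def)
      have "norm (y - z) = norm ((1 - t) *\<^sub>R a + t *\<^sub>R b)"
        by (simp add: z algebra_simps)
      also have "\<dots> \<le> norm a + norm b"
        using t by (intro order_trans[OF norm_triangle_ineq add_mono]) (auto intro: mult_left_le_one_le)
      finally have "1 + norm (y - z) \<le> 1 + norm a + norm b" by simp
      then have "(1 + norm y) ^ N \<le> (1 + norm z) ^ N * ?W"
        using weight_shift[of y N "y - z"]
        by (smt (verit) add.commute diff_diff_eq2 diff_add_cancel mult_left_mono norm_ge_zero power_mono zero_le_power add_diff_cancel_left')
      then have "(1 + norm y) ^ N * norm (partial_deriv i ?H z) \<le> (1 + norm z) ^ N * ?W * norm (partial_deriv i ?H z)"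
        by (intro mult_right_mono) auto
      also have "\<dots> \<le> M * ?W"
        using mult_right_mono[OF M[of "i # is" z], of ?W] len by (simp add: mult_ac)
      finally show ?thesis
        by (simp add: pos_le_divide_eq mult_ac add_pos_nonneg)
    qed
    then have "norm (?H (y - a) - ?H (y - b)) \<le> real CARD('n) * (M * ?W / (1 + norm y) ^ N) * norm ((y - a) - (y - b))"
      by (rule norm_diff_le_of_partials[OF H])
    then have "(1 + norm y) ^ N * norm (?H (y - a) - ?H (y - b))
        \<le> (1 + norm y) ^ N * (real CARD('n) * (M * ?W / (1 + norm y) ^ N) * norm ((y - a) - (y - b)))"
      by (intro mult_left_mono) auto
    also have "(1 + norm y) ^ N * (real CARD('n) * (M * ?W / (1 + norm y) ^ N) * norm ((y - a) - (y - b)))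
        = real CARD('n) * M * norm (a - b) * ?W"
    proof -
      have "(1 + norm y) ^ N \<noteq> 0" by (metis add_pos_nonneg norm_ge_zero less_numeral_extra(1,3) power_not_zero)
      then show ?thesis by (simp add: norm_minus_commute)
    qed
    also have "\<dots> \<le> (M + real CARD('n) * M) * norm (a - b) * ?W"
      using \<open>0 \<le> M\<close> by (intro mult_right_mono) auto
    finally show "(1 + norm y) ^ N * norm (?H (y - a) - ?H (y - b)) \<le> (M + real CARD('n) * M) * norm (a - b) * ?W" .
  qed
qed

text \<open>Derivatives of a convolution can all be put on the Schwartz factor, so of the other
  factor only integrability against polynomial weights is asked.\<close>

definition rapidly_integrable :: "('a::euclidean_space \<Rightarrow> complex) \<Rightarrow> bool" where
  "rapidly_integrable \<eta> \<longleftrightarrow> \<eta> \<in> borel_measurable borel \<and>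
     (\<forall>k::nat. integrable lborel (\<lambda>x. (1 + norm x) ^ k * norm (\<eta> x)))"

lemma rapidly_integrable_mult:
  assumes \<eta>: "rapidly_integrable \<eta>" and [measurable]: "h \<in> borel_measurable borel"
    and h: "\<And>x. norm (h x) \<le> C * (1 + norm x) ^ k"
  shows "integrable lborel (\<lambda>x. \<eta> x * h x)"
proof (rule Bochner_Integration.integrable_bound)
  have [measurable]: "\<eta> \<in> borel_measurable borel" using \<eta> by (simp add: rapidly_integrable_def)
  show "integrable lborel (\<lambda>x. C * ((1 + norm x) ^ k * norm (\<eta> x)))"
    using \<eta> by (simp add: rapidly_integrable_def)
  show "(\<lambda>x. \<eta> x * h x) \<in> borel_measurable lborel" by measurable
  show "AE x in lborel. norm (\<eta> x * h x) \<le> norm (C * ((1 + norm x) ^ k * norm (\<eta> x)))"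
  proof (intro AE_I2)
    fix x
    have "norm (\<eta> x * h x) \<le> norm (\<eta> x) * (C * (1 + norm x) ^ k)"
      unfolding norm_mult by (intro mult_left_mono h) auto
    also have "\<dots> \<le> norm (C * ((1 + norm x) ^ k * norm (\<eta> x)))"
      by (simp add: mult_ac)
    finally show "norm (\<eta> x * h x) \<le> norm (C * ((1 + norm x) ^ k * norm (\<eta> x)))" .
  qed
qed

text \<open>The variable \<open>y\<close> occurs in \<open>G\<close> alone: the convolution is read
  as a superposition of translates of \<open>G\<close>, weighted by \<eta>.\<close>

definition conv :: "(real ^ 'n::finite \<Rightarrow> complex) \<Rightarrow> (real ^ 'n \<Rightarrow> complex) \<Rightarrow> real ^ 'n \<Rightarrow> complex" where
  "conv \<eta> G y = (LINT x|lborel. \<eta> x * G (y - x))"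

lemma conv_integrable:
  assumes \<eta>: "rapidly_integrable \<eta>" and G: "schwartz G"
  shows "integrable lborel (\<lambda>x. \<eta> x * G (y - x))"
proof -
  obtain C where C: "\<And>x. (1 + norm x) ^ 0 * norm (partial_derivs [] G x) \<le> C"
    using schwartzD[OF G] by metis
  have [measurable]: "G \<in> borel_measurable borel" by (intro smooth_measurable schwartz_smooth G)
  show ?thesis
    by (rule rapidly_integrable_mult[OF \<eta>, of _ C 0]) (use C in auto)
qed

lemma conv_has_derivative:
  fixes G :: "real ^ 'n::finite \<Rightarrow> complex"
  assumes \<eta>: "rapidly_integrable \<eta>" and G: "schwartz G"
  shows "(conv \<eta> G has_derivative (\<lambda>h. \<Sum>i\<in>UNIV. (h $ i) *\<^sub>R conv \<eta> (partial_deriv i G) y)) (at y)"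
proof -
  have "\<exists>M. \<forall>z. norm (partial_deriv j (partial_deriv i G) z) \<le> M" for i j
    using schwartzD[OF G, of 0 "[j, i]"] by auto
  then obtain B where B: "\<And>i j z. norm (partial_deriv j (partial_deriv i G) z) \<le> B"
    by (rule uniform_bound_finite[where F = "\<lambda>i j z. norm (partial_deriv j (partial_deriv i G) z)"]) (rule that)
  define C where "C = real CARD('n) * (real CARD('n) * B)"
  show ?thesis
    unfolding conv_def[abs_def]
  proof (rule has_derivative_integral_partials)
    show "integrable lborel (\<lambda>x. \<eta> x * G (y - x))" for y by (rule conv_integrable[OF \<eta> G])
    show "integrable lborel (\<lambda>x. \<eta> x * partial_deriv i G (y - x))" for i
      by (intro conv_integrable \<eta> schwartz_partial_deriv G)
    have "integrable lborel (\<lambda>x. (1 + norm x) ^ 0 * norm (\<eta> x))"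
      using \<eta> unfolding rapidly_integrable_def by blast
    then show "integrable lborel (\<lambda>x. C * norm (\<eta> x))" by simp
    fix x h :: "real ^ 'n"
    have eq: "\<eta> x * G (y + h - x) - \<eta> x * G (y - x) - (\<Sum>i\<in>UNIV. (h $ i) *\<^sub>R (\<eta> x * partial_deriv i G (y - x)))
        = \<eta> x * (G ((y - x) + h) - G (y - x) - (\<Sum>i\<in>UNIV. (h $ i) *\<^sub>R partial_deriv i G (y - x)))"
      by (simp add: algebra_simps sum_distrib_left)
    show "norm (\<eta> x * G (y + h - x) - \<eta> x * G (y - x) - (\<Sum>i\<in>UNIV. (h $ i) *\<^sub>R (\<eta> x * partial_deriv i G (y - x))))
        \<le> C * norm (\<eta> x) * (norm h)\<^sup>2"
      unfolding eq norm_mult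
      using mult_left_mono[OF smooth_taylor_bound[OF schwartz_smooth[OF G] B, of "y - x" h] norm_ge_zero[of "\<eta> x"]]
      by (simp add: C_def mult_ac)
  qed
qed

lemma partial_derivs_conv:
  assumes \<eta>: "rapidly_integrable \<eta>" and G: "schwartz G"
  shows "partial_derivs is (conv \<eta> G) = conv \<eta> (partial_derivs is G) \<and> schwartz (partial_derivs is G)"
proof (induction "is")
  case (Cons i "is")
  have "partial_deriv i (conv \<eta> (partial_derivs is G)) y = conv \<eta> (partial_deriv i (partial_derivs is G)) y" for y
    using Cons by (subst partial_deriv_eq[OF conv_has_derivative[OF \<eta>]])
      (auto simp: axis_def if_distrib[of "\<lambda>c. c *\<^sub>R _"] cong: if_cong)
  with Cons show ?case by (auto intro: schwartz_partial_deriv)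
qed (simp add: G)

text \<open>Peetre's inequality splits the weight at \<open>y\<close> into a weight at
  \<open>y - x\<close>, absorbed by the decay of \<open>G\<close>, and a weight at \<open>x\<close>,
  absorbed by the integrability of \<eta>.\<close>

lemma schwartz_conv:
  assumes \<eta>: "rapidly_integrable \<eta>" and G: "schwartz G"
  shows "schwartz (conv \<eta> G)"
  unfolding schwartz_iff
proof (intro conjI allI)
  have PD: "partial_derivs is (conv \<eta> G) = conv \<eta> (partial_derivs is G)" "schwartz (partial_derivs is G)" for "is"
    using partial_derivs_conv[OF assms] by auto
  show "smooth (conv \<eta> G)"
    unfolding smooth_def PD using conv_has_derivative[OF \<eta> PD(2)] by (auto simp: differentiable_def)
  fix k "is"
  let ?H = "partial_derivs is G"
  obtain C where C: "0 \<le> C" "\<And>x. (1 + norm x) ^ k * norm (partial_derivs is G x) \<le> C"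
    using schwartzD[OF G] by metis
  have int: "integrable lborel (\<lambda>x. C * ((1 + norm x) ^ k * norm (\<eta> x)))"
    using \<eta> by (simp add: rapidly_integrable_def)
  have "(1 + norm y) ^ k * norm (conv \<eta> ?H y) \<le> (LINT x|lborel. C * ((1 + norm x) ^ k * norm (\<eta> x)))" for y
  proof -
    have "(1 + norm y) ^ k * norm (conv \<eta> ?H y) = norm (LINT x|lborel. (1 + norm y) ^ k *\<^sub>R (\<eta> x * ?H (y - x)))"
      unfolding conv_def by (simp add: norm_mult)
    also have "\<dots> \<le> (LINT x|lborel. C * ((1 + norm x) ^ k * norm (\<eta> x)))"
    proof (rule order_trans[OF integral_norm_bound integral_mono])
      fix x
      have "norm ((1 + norm y) ^ k *\<^sub>R (\<eta> x * ?H (y - x))) = (1 + norm y) ^ k * (norm (\<eta> x) * norm (?H (y - x)))"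
        by (simp add: norm_mult)
      also have "\<dots> \<le> ((1 + norm (y - x)) ^ k * (1 + norm x) ^ k) * (norm (\<eta> x) * norm (?H (y - x)))"
        by (intro mult_right_mono weight_shift) auto
      also have "\<dots> = ((1 + norm (y - x)) ^ k * norm (?H (y - x))) * ((1 + norm x) ^ k * norm (\<eta> x))"
        by (simp add: mult_ac)
      also have "\<dots> \<le> C * ((1 + norm x) ^ k * norm (\<eta> x))"
        by (intro mult_right_mono C) auto
      finally show "norm ((1 + norm y) ^ k *\<^sub>R (\<eta> x * ?H (y - x))) \<le> C * ((1 + norm x) ^ k * norm (\<eta> x))" .
    qed (use int conv_integrable[OF \<eta> PD(2)] in auto)
    finally show ?thesis .
  qed
  then show "\<exists>C. \<forall>x. (1 + norm x) ^ k * norm (partial_derivs is (conv \<eta> G) x) \<le> C"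
    unfolding PD by blast
qed

text \<open>The coefficients are integrals of \<eta> over the level sets of \<open>s\<close> and do
  not depend on \<open>h\<close>. The same ones therefore appear for the derivatives of translates
  of \<open>G\<close> and for the function \<open>g\<close> below, which is what links the two
  limits.\<close>

lemma integral_simple_function_comp:
  fixes \<eta> :: "'a \<Rightarrow> complex" and h :: "'b \<Rightarrow> complex"
  assumes \<eta>: "integrable M \<eta>" and s: "simple_function M s"
  shows "integrable M (\<lambda>x. \<eta> x * h (s x))"
    and "(LINT x|M. \<eta> x * h (s x)) =
      (\<Sum>z\<in>s ` space M. (LINT x|M. \<eta> x * indicator (s -` {z} \<inter> space M) x) * h z)"
proof -
  have fin: "finite (s ` space M)" and meas: "\<And>z. z \<in> s ` space M \<Longrightarrow> s -` {z} \<inter> space M \<in> sets M"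
    using s by (auto simp: simple_function_def)
  have int: "integrable M (\<lambda>x. \<eta> x * indicator (s -` {z} \<inter> space M) x * h z)" if "z \<in> s ` space M" for z
    using integrable_mult_indicator[OF meas[OF that] \<eta>] by (simp add: scaleR_conv_of_real mult.commute of_real_indicator)
  have eq: "\<eta> x * h (s x) = (\<Sum>z\<in>s ` space M. \<eta> x * indicator (s -` {z} \<inter> space M) x * h z)"
    if "x \<in> space M" for x
    using that fin by (subst sum.remove[of _ "s x"]) (auto simp: indicator_def intro!: sum.neutral)
  have "integrable M (\<lambda>x. \<Sum>z\<in>s ` space M. \<eta> x * indicator (s -` {z} \<inter> space M) x * h z)"
    using int by (intro Bochner_Integration.integrable_sum) auto
  then show "integrable M (\<lambda>x. \<eta> x * h (s x))"
    using eq by (simp cong: Bochner_Integration.integrable_cong)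
  have "(LINT x|M. \<eta> x * h (s x)) = (LINT x|M. (\<Sum>z\<in>s ` space M. \<eta> x * indicator (s -` {z} \<inter> space M) x * h z))"
    by (intro Bochner_Integration.integral_cong eq) auto
  also have "\<dots> = (\<Sum>z\<in>s ` space M. (LINT x|M. \<eta> x * indicator (s -` {z} \<inter> space M) x * h z))"
    using int by (intro Bochner_Integration.integral_sum) auto
  finally show "(LINT x|M. \<eta> x * h (s x)) =
      (\<Sum>z\<in>s ` space M. (LINT x|M. \<eta> x * indicator (s -` {z} \<inter> space M) x) * h z)"
    by simp
qed

text \<open>This is the exchange of \<open>u\<close> with the convolution integral. Linearity
  settles finite combinations of translates, and both sides are limits of these: one in the weighted
  norms of order \<open>N\<close> that dominate \<open>u\<close>, the other by dominated convergence
  for \<open>g\<close>.\<close>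

lemma translate_pairing:
  fixes G :: "real ^ 'n::finite \<Rightarrow> complex"
  assumes u: "tempered u" and G: "schwartz G"
  defines "g \<equiv> \<lambda>x. u (\<lambda>y. G (y - x))"
  shows "continuous_on UNIV g"
    and "\<And>\<eta>. rapidly_integrable \<eta> \<Longrightarrow> integrable lborel (\<lambda>x. g x * \<eta> x) \<and> u (conv \<eta> G) = (LINT x|lborel. g x * \<eta> x)"
proof -
  obtain C N where C: "0 \<le> C" and uC: "\<And>\<phi> B. schwartz \<phi> \<Longrightarrow>
      (\<And>is x. length is \<le> N \<Longrightarrow> (1 + norm x) ^ N * norm (partial_derivs is \<phi> x) \<le> B) \<Longrightarrow>
      norm (u \<phi>) \<le> C * B"
    using tempered_bound[OF u] by metis
  obtain M where M: "0 \<le> M"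
    "\<And>is a y. length is \<le> N \<Longrightarrow> (1 + norm y) ^ N * norm (partial_derivs is G (y - a)) \<le> M * (1 + norm a) ^ N"
    "\<And>is a b y. length is \<le> N \<Longrightarrow>
      (1 + norm y) ^ N * norm (partial_derivs is G (y - a) - partial_derivs is G (y - b))
        \<le> M * norm (a - b) * (1 + norm a + norm b) ^ N"
    using schwartz_translate_bounds[OF G, of N] by metis
  note sG = schwartz_smooth[OF G]
  \<comment> \<open>Polynomial growth of order \<open>N\<close>, which makes \<open>g\<close>
    integrable against \<eta> and provides the domination at the end.\<close>
  have gb: "norm (g a) \<le> C * M * (1 + norm a) ^ N" for a :: "real ^ 'n"
    unfolding g_def mult.assoc
    by (rule uC) (simp_all add: schwartz_translate G partial_derivs_translate sG M)
  have gd: "norm (g a - g b) \<le> C * (M * norm (a - b) * (1 + norm a + norm b) ^ N)" for a b :: "real ^ 'n"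
  proof -
    have "g a - g b = u (\<lambda>y. 1 * G (y - a) + (-1) * G (y - b))"
      unfolding g_def using G by (subst tempered_linear[OF u]) (auto intro: schwartz_translate)
    also have "norm \<dots> \<le> C * (M * norm (a - b) * (1 + norm a + norm b) ^ N)"
    proof (rule uC)
      show "schwartz (\<lambda>y. 1 * G (y - a) + (-1) * G (y - b))"
        by (intro schwartz_lincomb schwartz_translate G)
      show "(1 + norm x) ^ N * norm (partial_derivs is (\<lambda>y. 1 * G (y - a) + (-1) * G (y - b)) x)
          \<le> M * norm (a - b) * (1 + norm a + norm b) ^ N" if "length is \<le> N" for "is" x
        unfolding partial_derivs_lincomb[OF smooth_translate[OF sG] smooth_translate[OF sG]] partial_derivs_translate[OF sG]
        using M(3)[OF that] by simp
    qed
    finally show ?thesis .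
  qed
  show cont: "continuous_on UNIV g"
    unfolding continuous_on_eq_continuous_at[OF open_UNIV] isCont_def
  proof
    fix a :: "real ^ 'n"
    have "((\<lambda>b. C * (M * norm (b - a) * (1 + norm b + norm a) ^ N)) \<longlongrightarrow>
        C * (M * norm (a - a) * (1 + norm a + norm a) ^ N)) (at a)"
      by (intro tendsto_intros)
    then have "((\<lambda>b. C * (M * norm (b - a) * (1 + norm b + norm a) ^ N)) \<longlongrightarrow> 0) (at a)" by simp
    then have "((\<lambda>b. g b - g a) \<longlongrightarrow> 0) (at a)"
      by (rule Lim_null_comparison[rotated]) (use gd in auto)
    then show "(g \<longlongrightarrow> g a) (at a)" by (simp add: LIM_zero_iff)
  qed
  then have gm [measurable]: "g \<in> borel_measurable borel" by (rule borel_measurable_continuous_onI)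
  fix \<eta> :: "real ^ 'n \<Rightarrow> complex" assume \<eta>: "rapidly_integrable \<eta>"
  then have [measurable]: "\<eta> \<in> borel_measurable borel" by (simp add: rapidly_integrable_def)
  have \<eta>int: "integrable lborel \<eta>"
    using rapidly_integrable_mult[OF \<eta>, of "\<lambda>x. 1" 1 0] by simp
  have int: "integrable lborel (\<lambda>x. \<eta> x * g x)"
    by (rule rapidly_integrable_mult[OF \<eta> gm gb])
  \<comment> \<open>Besides pointwise convergence, the bound by twice the distance to 0 matters: it
    keeps polynomial weights at \<open>s i x\<close> comparable to those at \<open>x\<close>,
    uniformly in \<open>i\<close>.\<close>
  obtain s :: "nat \<Rightarrow> real ^ 'n \<Rightarrow> real ^ 'n"
    where "\<forall>i. simple_function lborel (s i)" "\<forall>x\<in>space lborel. (\<lambda>i. s i x) \<longlonglongrightarrow> x"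
      "\<forall>i. \<forall>x\<in>space lborel. dist (s i x) 0 \<le> 2 * dist x 0"
    using borel_measurable_implies_sequence_metric[of "\<lambda>x::real^'n. x" lborel 0] by auto
  then have s: "\<And>i. simple_function lborel (s i)" "\<And>x. (\<lambda>i. s i x) \<longlonglongrightarrow> x"
    and sb: "\<And>i x. norm (s i x) \<le> 2 * norm x"
    by auto
  have sm [measurable]: "s i \<in> borel_measurable borel" for i
    using borel_measurable_simple_function[OF s(1)[of i]] by simp
  have w3: "(1 + norm (s i x) + norm x) ^ k \<le> 3 ^ k * (1 + norm x) ^ k" for i x k
  proof -
    have "1 + norm (s i x) + norm x \<le> 3 * (1 + norm x)" using sb[of i x] by simp
    then show ?thesis by (metis add_nonneg_nonneg norm_ge_zero power_mono power_mult_distrib zero_le_one)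
  qed
  \<comment> \<open>Only the translation parameter is discretised, not \<open>\<eta>\<close>: \<open>R i y\<close> is the integral of
    \<open>\<eta> x * G (y - s i x)\<close> and a finite combination of translates of \<open>G\<close>.\<close>
  define c where "c i z = (LINT x|lborel. \<eta> x * indicator (s i -` {z} \<inter> space lborel) x)" for i z
  define F where "F i = s i ` space lborel" for i
  have F: "finite (F i)" for i using s(1)[of i] by (auto simp: F_def simple_function_def)
  have comp: "integrable lborel (\<lambda>x. \<eta> x * h (s i x))"
      "(LINT x|lborel. \<eta> x * h (s i x)) = (\<Sum>z\<in>F i. c i z * h z)" for i h
    using integral_simple_function_comp[OF \<eta>int s(1)] unfolding c_def F_def by auto
  define R where "R i = (\<lambda>y. \<Sum>z\<in>F i. c i z * G (y - z))" for i
  have R: "schwartz (R i)" "u (R i) = (\<Sum>z\<in>F i. c i z * g z)"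
      "partial_derivs is (R i) = (\<lambda>y. \<Sum>z\<in>F i. c i z * partial_derivs is G (y - z))" for i "is"
    using tempered_sum[OF u F, where \<phi> = "\<lambda>z y. G (y - z)" and c = "c i"] schwartz_translate[OF G]
    unfolding R_def g_def partial_derivs_translate[OF sG] by auto
  \<comment> \<open>\<open>b i\<close> comes from integrating the Lipschitz bound for translates. It
    dominates the order-\<open>N\<close> norms of \<open>R i\<close> minus the convolution, whatever
    \<open>y\<close> and \<open>is\<close>.\<close>
  define b where "b i = (LINT x|lborel. norm (\<eta> x) * (M * norm (s i x - x) * (1 + norm (s i x) + norm x) ^ N))" for i
  \<comment> \<open>The extra power absorbs \<open>norm (s i x - x)\<close>, which may grow linearly
    in \<open>x\<close>; the 3 comes from \<open>w3\<close>.\<close>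
  have dom: "integrable lborel (\<lambda>x. M * 3 ^ (N + 1) * ((1 + norm x) ^ (N + 1) * norm (\<eta> x)))"
    using \<eta> unfolding rapidly_integrable_def by (intro integrable_mult_right) blast
  have domle: "norm (norm (\<eta> x) * (M * norm (s i x - x) * (1 + norm (s i x) + norm x) ^ N))
      \<le> M * 3 ^ (N + 1) * ((1 + norm x) ^ (N + 1) * norm (\<eta> x))" for i x
  proof -
    have "norm (s i x - x) \<le> 1 + norm (s i x) + norm x" using norm_triangle_ineq4[of "s i x" x] by simp
    then have "norm (s i x - x) * (1 + norm (s i x) + norm x) ^ N \<le> (1 + norm (s i x) + norm x) ^ (N + 1)"
      by (simp add: mult_right_mono)
    also note w3
    finally have "M * norm (\<eta> x) * (norm (s i x - x) * (1 + norm (s i x) + norm x) ^ N)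
        \<le> M * norm (\<eta> x) * (3 ^ (N + 1) * (1 + norm x) ^ (N + 1))"
      using M(1) by (intro mult_left_mono) auto
    then show ?thesis
      using M(1) by (simp add: abs_mult mult_ac)
  qed
  have intb: "integrable lborel (\<lambda>x. norm (\<eta> x) * (M * norm (s i x - x) * (1 + norm (s i x) + norm x) ^ N))" for i
    by (rule Bochner_Integration.integrable_bound[OF dom]) (use domle in \<open>auto intro!: AE_I2 intro: order_trans[OF _ abs_ge_self]\<close>)
  have ub: "norm (u (R i) - u (conv \<eta> G)) \<le> C * b i" for i
  proof -
    have "u (R i) - u (conv \<eta> G) = u (\<lambda>y. 1 * R i y + (-1) * conv \<eta> G y)"
      using R(1) schwartz_conv[OF \<eta> G] by (subst tempered_linear[OF u]) auto
    also have "norm \<dots> \<le> C * b i"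
    proof (rule uC)
      show "schwartz (\<lambda>y. 1 * R i y + (-1) * conv \<eta> G y)"
        using R(1) schwartz_conv[OF \<eta> G] by (rule schwartz_lincomb)
      fix "is" :: "'n list" and y assume len: "length is \<le> N"
      let ?H = "partial_derivs is G"
      have H: "schwartz ?H" and dc: "partial_derivs is (conv \<eta> G) = conv \<eta> ?H"
        using partial_derivs_conv[OF \<eta> G] by auto
      have iH: "integrable lborel (\<lambda>x. \<eta> x * ?H (y - x))" by (rule conv_integrable[OF \<eta> H])
      have "partial_derivs is (\<lambda>y. 1 * R i y + (-1) * conv \<eta> G y) y = partial_derivs is (R i) y - conv \<eta> ?H y"
        using R(1) schwartz_conv[OF \<eta> G] by (subst partial_derivs_lincomb) (auto simp: schwartz_smooth dc)
      also have "\<dots> = (LINT x|lborel. \<eta> x * ?H (y - s i x)) - (LINT x|lborel. \<eta> x * ?H (y - x))"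
        unfolding R(3) conv_def comp(2)[of "\<lambda>z. ?H (y - z)"] ..
      also have "\<dots> = (LINT x|lborel. \<eta> x * (?H (y - s i x) - ?H (y - x)))"
        using comp(1)[of "\<lambda>z. ?H (y - z)" i] iH by (simp add: right_diff_distrib)
      finally have "(1 + norm y) ^ N * norm (partial_derivs is (\<lambda>y. 1 * R i y + (-1) * conv \<eta> G y) y)
          = norm (LINT x|lborel. (1 + norm y) ^ N *\<^sub>R (\<eta> x * (?H (y - s i x) - ?H (y - x))))"
        by simp
      also have "\<dots> \<le> b i"
        unfolding b_def
      proof (rule order_trans[OF integral_norm_bound integral_mono])
        show "integrable lborel (\<lambda>x. norm ((1 + norm y) ^ N *\<^sub>R (\<eta> x * (?H (y - s i x) - ?H (y - x)))))"
          using comp(1)[of "\<lambda>z. ?H (y - z)" i] iH by (simp add: right_diff_distrib)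
        fix x
        show "norm ((1 + norm y) ^ N *\<^sub>R (\<eta> x * (?H (y - s i x) - ?H (y - x))))
            \<le> norm (\<eta> x) * (M * norm (s i x - x) * (1 + norm (s i x) + norm x) ^ N)"
          using mult_left_mono[OF M(3)[OF len, of y "s i x" x] norm_ge_zero[of "\<eta> x"]]
          by (simp add: norm_mult mult_ac)
      qed (rule intb)
      finally show "(1 + norm y) ^ N * norm (partial_derivs is (\<lambda>y. 1 * R i y + (-1) * conv \<eta> G y) y) \<le> b i" .
    qed
    finally show ?thesis .
  qed
  have "b \<longlonglongrightarrow> (LINT x|(lborel :: (real ^ 'n) measure). 0)"
    unfolding b_def
  proof (rule integral_dominated_convergence[OF _ _ dom])
    show "AE x in lborel. (\<lambda>i. norm (\<eta> x) * (M * norm (s i x - x) * (1 + norm (s i x) + norm x) ^ N)) \<longlonglongrightarrow> 0"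
    proof (intro AE_I2)
      fix x
      have "(\<lambda>i. norm (\<eta> x) * (M * norm (s i x - x) * (1 + norm (s i x) + norm x) ^ N))
          \<longlonglongrightarrow> norm (\<eta> x) * (M * norm (x - x) * (1 + norm x + norm x) ^ N)"
        by (intro tendsto_intros s(2))
      then show "(\<lambda>i. norm (\<eta> x) * (M * norm (s i x - x) * (1 + norm (s i x) + norm x) ^ N)) \<longlonglongrightarrow> 0"
        by simp
    qed
  qed (use domle in auto)
  then have "b \<longlonglongrightarrow> 0" by simp
  then have "(\<lambda>i. C * b i) \<longlonglongrightarrow> 0" by (rule tendsto_mult_right_zero)
  then have "(\<lambda>i. u (R i) - u (conv \<eta> G)) \<longlonglongrightarrow> 0"
    by (rule Lim_null_comparison[rotated]) (use ub in auto)
  then have lim1: "(\<lambda>i. u (R i)) \<longlonglongrightarrow> u (conv \<eta> G)" by (simp add: LIM_zero_iff)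
  \<comment> \<open>These integrals equal \<open>u (R i)\<close>, so this is a second computation of
    the limit in \<open>lim1\<close>; here continuity of \<open>g\<close> gives the pointwise
    convergence.\<close>
  have "(\<lambda>i. LINT x|lborel. \<eta> x * g (s i x)) \<longlonglongrightarrow> (LINT x|lborel. \<eta> x * g x)"
  proof (rule integral_dominated_convergence)
    show "integrable lborel (\<lambda>x. C * M * 3 ^ N * ((1 + norm x) ^ N * norm (\<eta> x)))"
      using \<eta> unfolding rapidly_integrable_def by (intro integrable_mult_right) blast
    show "AE x in lborel. norm (\<eta> x * g (s i x)) \<le> C * M * 3 ^ N * ((1 + norm x) ^ N * norm (\<eta> x))" for i
    proof (intro AE_I2)
      fix x
      have "(1 + norm (s i x)) ^ N \<le> (1 + norm (s i x) + norm x) ^ N" by (intro power_mono) auto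
      also note w3
      finally have "norm (g (s i x)) \<le> C * M * (3 ^ N * (1 + norm x) ^ N)"
        using C M(1) by (intro order_trans[OF gb] mult_left_mono) auto
      then have "norm (\<eta> x) * norm (g (s i x)) \<le> norm (\<eta> x) * (C * M * (3 ^ N * (1 + norm x) ^ N))"
        by (rule mult_left_mono) simp
      then show "norm (\<eta> x * g (s i x)) \<le> C * M * 3 ^ N * ((1 + norm x) ^ N * norm (\<eta> x))"
        by (simp add: norm_mult mult_ac)
    qed
    show "AE x in lborel. (\<lambda>i. \<eta> x * g (s i x)) \<longlonglongrightarrow> \<eta> x * g x"
    proof (intro AE_I2 tendsto_mult_left)
      fix x
      have "isCont g x" using cont by (simp add: continuous_on_eq_continuous_at)
      then show "(\<lambda>i. g (s i x)) \<longlonglongrightarrow> g x" using s(2) by (rule isCont_tendsto_compose)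
    qed
  qed auto
  then have "(\<lambda>i. u (R i)) \<longlonglongrightarrow> (LINT x|lborel. \<eta> x * g x)"
    by (simp add: R(2) comp(2))
  with lim1 have "u (conv \<eta> G) = (LINT x|lborel. \<eta> x * g x)" by (rule LIMSEQ_unique)
  with int show "integrable lborel (\<lambda>x. g x * \<eta> x) \<and> u (conv \<eta> G) = (LINT x|lborel. g x * \<eta> x)"
    by (simp add: mult.commute)
qed

subsection \<open>Dyadic blocks\<close>

text \<open>The weight is dominated by a series over balls of radius k + 1. Their volume cancels all
  but two powers of 1 + k, leaving a convergent sum. Full balls instead of shells are the reason for
  the exponent d + 2.\<close>

lemma integrable_inverse_weight:
  "integrable lborel (\<lambda>x::'a::euclidean_space. 1 / (1 + norm x) ^ (DIM('a) + 2))"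
proof -
  let ?d = "DIM('a)"
  let ?t = "\<lambda>(k::nat) (x::'a). ennreal (1 / (1 + real k) ^ (?d + 2)) * indicator (cball 0 (real k + 1)) x"
  have term_le: "f k \<le> (\<Sum>k. f k)" for f :: "nat \<Rightarrow> ennreal" and k
    using sum_le_suminf[of f "{k}"] by simp
  have "(\<integral>\<^sup>+(x::'a). ennreal (1 / (1 + norm x) ^ (?d + 2)) \<partial>lborel) \<le> (\<integral>\<^sup>+x. (\<Sum>k. ?t k x) \<partial>lborel)"
  proof (rule nn_integral_mono)
    fix x :: 'a
    \<comment> \<open>The single term of this index already dominates the weight at
      \<open>x\<close>.\<close>
    define k where "k = nat \<lfloor>norm x\<rfloor>"
    have "real k = of_int \<lfloor>norm x\<rfloor>" by (simp add: k_def)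
    then have k: "real k \<le> norm x" "norm x \<le> real k + 1" by linarith+
    have "ennreal (1 / (1 + norm x) ^ (?d + 2)) \<le> ennreal (1 / (1 + real k) ^ (?d + 2))"
      using k by (intro ennreal_leI divide_left_mono power_mono) auto
    also have "\<dots> = ?t k x" using k by simp
    also have "\<dots> \<le> (\<Sum>k. ?t k x)" by (rule term_le)
    finally show "ennreal (1 / (1 + norm x) ^ (?d + 2)) \<le> (\<Sum>k. ?t k x)" .
  qed
  also have "\<dots> = (\<Sum>k. \<integral>\<^sup>+x. ?t k x \<partial>lborel)"
    by (intro nn_integral_suminf borel_measurable_times_ennreal borel_measurable_const borel_measurable_indicator) auto
  also have "\<dots> = (\<Sum>k. ennreal (unit_ball_vol ?d * (1 / (1 + real k)\<^sup>2)))"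
  proof (rule suminf_cong)
    fix k :: nat
    have "(\<integral>\<^sup>+x. ?t k x \<partial>lborel) = ennreal (1 / (1 + real k) ^ (?d + 2)) * emeasure lborel (cball (0::'a) (real k + 1))"
      by (rule nn_integral_cmult_indicator) auto
    also have "\<dots> = ennreal (1 / (1 + real k) ^ (?d + 2) * (unit_ball_vol ?d * (real k + 1) ^ ?d))"
      by (subst emeasure_cball, simp, intro ennreal_mult[symmetric]) auto
    also have "1 / (1 + real k) ^ (?d + 2) * (unit_ball_vol ?d * (real k + 1) ^ ?d) = unit_ball_vol ?d * (1 / (1 + real k)\<^sup>2)"
    proof -
      have "(1 + real k) ^ ?d \<noteq> 0" by simp
      then show ?thesis by (simp add: power_add power2_eq_square add.commute[of "real k" 1])
    qed
    finally show "(\<integral>\<^sup>+x. ?t k x \<partial>lborel) = ennreal (unit_ball_vol ?d * (1 / (1 + real k)\<^sup>2))" .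
  qed
  also have "\<dots> < \<infinity>"
  proof -
    have "summable (\<lambda>k. 1 / (1 + real k)\<^sup>2)"
      using inverse_squares_sums by (simp add: sums_iff add.commute)
    then have "summable (\<lambda>k. unit_ball_vol ?d * (1 / (1 + real k)\<^sup>2))"
      by (rule summable_mult)
    then have "(\<Sum>k. ennreal (unit_ball_vol ?d * (1 / (1 + real k)\<^sup>2))) \<noteq> top"
      by (intro ennreal_suminf_neq_top) (auto intro!: mult_nonneg_nonneg)
    then show ?thesis by (simp add: less_top)
  qed
  finally show ?thesis
    by (intro integrableI_nonneg) auto
qed

lemma schwartz_rapidly_integrable:
  fixes \<eta> :: "real ^ 'n::finite \<Rightarrow> complex"
  assumes "schwartz \<eta>"
  shows "rapidly_integrable \<eta>"
  unfolding rapidly_integrable_def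
proof (intro conjI allI)
  show m [measurable]: "\<eta> \<in> borel_measurable borel" by (intro smooth_measurable schwartz_smooth assms)
  fix k :: nat
  let ?d = "DIM(real ^ 'n) + 2"
  obtain C where C: "0 \<le> C" "\<And>x. (1 + norm x) ^ (k + ?d) * norm (partial_derivs [] \<eta> x) \<le> C"
    using schwartzD[OF assms] by metis
  show "integrable lborel (\<lambda>x. (1 + norm x) ^ k * norm (\<eta> x))"
  proof (rule Bochner_Integration.integrable_bound)
    show "integrable lborel (\<lambda>x :: real ^ 'n. C * (1 / (1 + norm x) ^ ?d))"
      by (intro integrable_mult_right integrable_inverse_weight)
    show "AE x in lborel. norm ((1 + norm x) ^ k * norm (\<eta> x)) \<le> norm (C * (1 / (1 + norm x) ^ ?d))"
    proof (intro AE_I2)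
      fix x :: "real ^ 'n"
      have pos: "0 < (1 + norm x) ^ ?d" by (intro zero_less_power) (simp add: add_pos_nonneg)
      have "((1 + norm x) ^ k * norm (\<eta> x)) * (1 + norm x) ^ ?d \<le> C"
        using C(2)[of x] unfolding power_add[of _ k] partial_derivs.simps by (simp only: mult_ac)
      then have "(1 + norm x) ^ k * norm (\<eta> x) \<le> C / (1 + norm x) ^ ?d"
        using pos by (simp only: pos_le_divide_eq)
      then show "norm ((1 + norm x) ^ k * norm (\<eta> x)) \<le> norm (C * (1 / (1 + norm x) ^ ?d))"
        using C(1) pos by (simp add: abs_mult)
    qed
  qed measurable
qed

lemma rapidly_integrable_integrable: "rapidly_integrable \<eta> \<Longrightarrow> integrable lborel \<eta>"
  using rapidly_integrable_mult[of \<eta> "\<lambda>x. 1" 1 0] by simp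

text \<open>The phases of the two transforms merge into \<open>wave \<xi> (y - x)\<close>, and
  integrating over \<xi> first leaves the transform of \<open>m\<close> at \<open>y - x\<close>. The
  normalising factor of \<open>inv_fourier\<close> passes to the kernel.\<close>

lemma fourier_mult_inv_fourier:
  fixes m \<eta> :: "real ^ 'n::finite \<Rightarrow> complex"
  assumes m: "integrable lborel m" and \<eta>: "integrable lborel \<eta>"
  shows "fourier (\<lambda>\<xi>. m \<xi> * inv_fourier \<eta> \<xi>) =
    conv \<eta> (\<lambda>y. complex_of_real (1 / (2 * pi) ^ CARD('n)) * fourier m y)"
proof
  fix y :: "real ^ 'n"
  define c where "c = complex_of_real (1 / (2 * pi) ^ CARD('n))"
  have [measurable]: "m \<in> borel_measurable borel" "\<eta> \<in> borel_measurable borel" using m \<eta> by auto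
  let ?f = "\<lambda>\<xi> x. wave \<xi> (y - x) * m \<xi> * \<eta> x"
  have nf: "norm (?f \<xi> x) = norm (m \<xi>) * norm (\<eta> x)" for \<xi> x
    by (simp add: norm_mult)
  have "integrable (lborel \<Otimes>\<^sub>M lborel) (\<lambda>(\<xi>, x). ?f \<xi> x)"
  proof (rule lborel_pair.Fubini_integrable)
    show "(\<lambda>(\<xi>, x). ?f \<xi> x) \<in> borel_measurable (lborel \<Otimes>\<^sub>M lborel)"
      by measurable
    have "integrable lborel (\<lambda>\<xi>. norm (m \<xi>) * (LINT x|lborel. norm (\<eta> x)))"
      using m by (intro integrable_mult_left integrable_norm)
    then show "integrable lborel (\<lambda>\<xi>. LINT x|lborel. norm (case (\<xi>, x) of (\<xi>, x) \<Rightarrow> ?f \<xi> x))"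
      by (simp add: nf norm_mult)
    show "AE \<xi> in lborel. integrable lborel (\<lambda>x. case (\<xi>, x) of (\<xi>, x) \<Rightarrow> ?f \<xi> x)"
    proof (intro AE_I2)
      fix \<xi> :: "real ^ 'n"
      have "integrable lborel (\<lambda>x. norm (m \<xi>) * norm (\<eta> x))"
        using \<eta> by (intro integrable_mult_right integrable_norm)
      then show "integrable lborel (\<lambda>x. case (\<xi>, x) of (\<xi>, x) \<Rightarrow> ?f \<xi> x)"
        by (rule Bochner_Integration.integrable_bound) (auto simp: norm_mult)
    qed
  qed
  from lborel_pair.Fubini_integral[OF this]
  have fub: "(LINT x|lborel. LINT \<xi>|lborel. ?f \<xi> x) = (LINT \<xi>|lborel. LINT x|lborel. ?f \<xi> x)" .
  have "fourier (\<lambda>\<xi>. m \<xi> * inv_fourier \<eta> \<xi>) y = (LINT \<xi>|lborel. c * (LINT x|lborel. ?f \<xi> x))"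
    unfolding fourier_def
  proof (rule Bochner_Integration.integral_cong)
    fix \<xi> :: "real ^ 'n"
    have "(\<lambda>x. ?f \<xi> x) = (\<lambda>x. (wave \<xi> y * m \<xi>) * (exp (\<i> * complex_of_real (\<xi> \<bullet> x)) * \<eta> x))"
      by (simp add: fun_eq_iff inner_diff_right exp_add[symmetric] algebra_simps)
    then show "wave \<xi> y * (m \<xi> * inv_fourier \<eta> \<xi>) = c * (LINT x|lborel. ?f \<xi> x)"
      unfolding inv_fourier_def c_def by (simp only: integral_mult_right_zero) (simp add: mult_ac)
  qed simp
  also have "\<dots> = c * (LINT x|lborel. LINT \<xi>|lborel. ?f \<xi> x)"
    by (simp only: integral_mult_right_zero fub)
  also have "\<dots> = (LINT x|lborel. \<eta> x * (c * fourier m (y - x)))"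
    unfolding fourier_def integral_mult_right_zero[symmetric] by (simp add: mult_ac)
  finally show "fourier (\<lambda>\<xi>. m \<xi> * inv_fourier \<eta> \<xi>) y = conv \<eta> (\<lambda>y. c * fourier m y) y"
    by (simp add: conv_def)
qed

lemma test_fun_dyadic_multiplier:
  fixes \<phi> :: "real ^ 'n::finite \<Rightarrow> real"
  assumes "lp_cutoff \<phi>"
  shows "test_fun (\<lambda>\<xi>. complex_of_real (lp_psi \<phi> ((2 powi (- j)) *\<^sub>R \<xi>)))"
proof -
  have sm: "smooth \<phi>" and z: "\<And>\<xi>. 1 \<le> norm \<xi> \<Longrightarrow> \<phi> \<xi> = 0"
    using assms by (auto simp: lp_cutoff_def smooth_compact_support_def)
  have T: "test_fun (\<lambda>\<xi>. complex_of_real (\<phi> (c *\<^sub>R \<xi>)))" if "0 < c" for c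
    unfolding test_fun_def
  proof (intro conjI exI allI impI)
    show "smooth (\<lambda>\<xi>. complex_of_real (\<phi> (c *\<^sub>R \<xi>)))"
      using smooth_affine[OF sm, of c 0] by (intro smooth_bounded_linear[OF bounded_linear_of_real]) simp
    fix \<xi> :: "real ^ 'n" assume "1 / c < norm \<xi>"
    then show "complex_of_real (\<phi> (c *\<^sub>R \<xi>)) = 0"
      using that by (simp add: z field_simps)
  qed
  let ?c = "2 powi (- j) :: real"
  have "test_fun (\<lambda>\<xi>. complex_of_real (\<phi> ((?c / 2) *\<^sub>R \<xi>)) + (-1) * complex_of_real (\<phi> (?c *\<^sub>R \<xi>)))"
    by (intro test_fun_add test_fun_mult_left T) auto
  moreover have "complex_of_real (lp_psi \<phi> (c *\<^sub>R \<xi>)) =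
      complex_of_real (\<phi> ((c / 2) *\<^sub>R \<xi>)) + (-1) * complex_of_real (\<phi> (c *\<^sub>R \<xi>))" for c \<xi>
    by (simp add: lp_psi_def)
  ultimately show ?thesis by (simp only:)
qed

lemma schwartz_mult_left: "schwartz f \<Longrightarrow> schwartz (\<lambda>x. c * f x)"
  using schwartz_lincomb[of f f c 0] by simp

text \<open>The function selected by \<open>continuous_rep\<close> is never identified: exhibiting
  some continuous representative \<open>g\<close> already gives the choice both properties.\<close>

lemma dyadic_block_fun:
  assumes "lp_cutoff \<phi>" and f: "tempered f"
  shows "continuous_on UNIV (dyadic_block_fun \<phi> j f)" (is ?cont)
    and "represents (dyadic_block_fun \<phi> j f) (dyadic_block \<phi> j f)" (is ?rep)
proof -
  let ?m = "\<lambda>\<xi>. complex_of_real (lp_psi \<phi> ((2 powi (- j)) *\<^sub>R \<xi>))"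
  let ?G = "\<lambda>y. complex_of_real (1 / (2 * pi) ^ CARD('a)) * fourier ?m y"
  have m: "test_fun ?m" by (rule test_fun_dyadic_multiplier[OF assms(1)])
  have G: "schwartz ?G" by (intro schwartz_mult_left schwartz_fourier_test_fun m)
  define g where "g x = f (\<lambda>y. ?G (y - x))" for x
  have cont: "continuous_on UNIV g" and
    pair: "\<And>\<eta>. rapidly_integrable \<eta> \<Longrightarrow> integrable lborel (\<lambda>x. g x * \<eta> x) \<and> f (conv \<eta> ?G) = (LINT x|lborel. g x * \<eta> x)"
    using translate_pairing[OF f G] unfolding g_def by blast+
  have "represents g (dyadic_block \<phi> j f)"
    unfolding represents_def
  proof (intro conjI allI impI)
    show "g \<in> borel_measurable lborel" using borel_measurable_continuous_onI[OF cont] by simp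
    fix \<eta> :: "real ^ 'a \<Rightarrow> complex" assume "schwartz \<eta>"
    then have \<eta>: "rapidly_integrable \<eta>" by (rule schwartz_rapidly_integrable)
    show "integrable lborel (\<lambda>x. g x * \<eta> x)" using pair[OF \<eta>] by blast
    show "dyadic_block \<phi> j f \<eta> = (LINT x|lborel. g x * \<eta> x)"
      using pair[OF \<eta>] fourier_mult_inv_fourier[OF test_fun_integrable[OF m] rapidly_integrable_integrable[OF \<eta>]]
      by (simp add: dyadic_block_def inv_fourier_distr_def mult_distr_def fourier_distr_def)
  qed
  with cont have "\<exists>g. continuous_on UNIV g \<and> represents g (dyadic_block \<phi> j f)" by blast
  from someI_ex[OF this] show ?cont ?rep
    unfolding dyadic_block_fun_def continuous_rep_def by blast+
qed

subsection \<open>Interpolation inequalities\<close>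

lemma sum_power_le_geometric:
  fixes r :: real
  assumes "0 \<le> r" "r < 1" "finite F" "inj_on f F"
  shows "(\<Sum>j\<in>F. r ^ f j) \<le> 1 / (1 - r)"
proof -
  have "(\<Sum>j\<in>F. r ^ f j) = (\<Sum>i\<in>f ` F. r ^ i)"
    using assms(4) by (simp add: sum.reindex)
  also have "\<dots> \<le> (\<Sum>i. r ^ i)"
    using assms by (intro sum_le_suminf) (auto intro: summable_geometric)
  also have "\<dots> = 1 / (1 - r)" using assms by (intro suminf_geometric) auto
  finally show ?thesis .
qed

text \<open>The distance to \<open>j0\<close> is injective on either side of \<open>j0\<close>, so
  each side is bounded by a full geometric series.\<close>

lemma sum_int_power_le:
  fixes r :: real and F :: "int set"
  assumes r: "0 \<le> r" "r < 1" and F: "finite F"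
  shows "(\<Sum>j\<in>F. r ^ nat \<bar>j - j0\<bar>) \<le> 2 / (1 - r)"
proof -
  have "(\<Sum>j\<in>F. r ^ nat \<bar>j - j0\<bar>) = (\<Sum>j\<in>F \<inter> {j0..}. r ^ nat \<bar>j - j0\<bar>) + (\<Sum>j\<in>F - {j0..}. r ^ nat \<bar>j - j0\<bar>)"
    using F by (rule sum.Int_Diff)
  also have "\<dots> \<le> 1 / (1 - r) + 1 / (1 - r)"
    using r F by (intro add_mono sum_power_le_geometric) (auto simp: inj_on_def)
  finally show ?thesis by simp
qed

text \<open>\<open>C\<close> is fixed before \<open>A\<close>, \<open>B\<close> and
  \<open>d\<close>, so one constant serves all points and all distributions. Each \<open>d j\<close>
  is at most the common value of the two bounds at their crossing point, times a factor decaying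
  with the distance to it.\<close>

lemma sum_geometric_interpolation:
  fixes \<alpha> \<beta> :: real
  assumes \<alpha>: "0 < \<alpha>" and \<beta>: "0 < \<beta>" and \<theta>: "\<theta> = \<alpha> / (\<alpha> + \<beta>)"
  obtains C where "0 < C"
    "\<And>A B (d :: int \<Rightarrow> real) F. \<lbrakk>0 \<le> A; 0 \<le> B; \<And>j. 0 \<le> d j;
      \<And>j. d j \<le> 2 powr (- (real_of_int j * \<alpha>)) * A; \<And>j. d j \<le> 2 powr (real_of_int j * \<beta>) * B; finite F\<rbrakk>
      \<Longrightarrow> (\<Sum>j\<in>F. d j) \<le> C * (A powr (1 - \<theta>) * B powr \<theta>)"
proof -
  define \<gamma> where "\<gamma> = min \<alpha> \<beta>"
  define r where "r = 2 powr (- \<gamma>)"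
  have \<gamma>: "0 < \<gamma>" using \<alpha> \<beta> by (simp add: \<gamma>_def)
  have r: "0 < r" "r < 1"
    using \<gamma> powr_less_mono[of "- \<gamma>" 0 2] by (auto simp: r_def)
  have r_pow: "r ^ n = 2 powr (- \<gamma> * real n)" for n
    using r(1) by (simp add: powr_realpow[symmetric] r_def powr_powr)
  \<comment> \<open>The first factor pays for rounding the crossing point to an integer, the second
    is the two-sided geometric series.\<close>
  define C where "C = 2 powr \<gamma> * (2 / (1 - r))"
  have \<theta>1: "1 - \<theta> = \<beta> / (\<alpha> + \<beta>)" using \<alpha> \<beta> by (simp add: \<theta> field_simps)
  have "(\<Sum>j\<in>F. d j) \<le> C * (A powr (1 - \<theta>) * B powr \<theta>)"
    if A: "0 \<le> A" and B: "0 \<le> B" and d: "\<And>j. 0 \<le> d j"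
      and dA: "\<And>j. d j \<le> 2 powr (- (real_of_int j * \<alpha>)) * A"
      and dB: "\<And>j. d j \<le> 2 powr (real_of_int j * \<beta>) * B" and F: "finite F"
    for A B :: real and d :: "int \<Rightarrow> real" and F
  proof (cases "A = 0 \<or> B = 0")
    case True
    then have "d j = 0" for j using d[of j] dA[of j] dB[of j] by auto
    then show ?thesis using r by (simp add: C_def)
  next
    case False
    then have AB: "0 < A" "0 < B" using A B by auto
    define X where "X = A powr (1 - \<theta>) * B powr \<theta>"
    \<comment> \<open>The real index at which the decreasing and the increasing bound coincide;
      \<open>X\<close> is their common value there, as \<open>AX\<close> and \<open>BX\<close>
      express.\<close>
    define t where "t = log 2 (A / B) / (\<alpha> + \<beta>)"
    have X: "0 < X" using AB by (simp add: X_def)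
    have t: "2 powr (t * \<delta>) = (A / B) powr (\<delta> / (\<alpha> + \<beta>))" for \<delta>
    proof -
      have "2 powr (t * \<delta>) = (2 powr log 2 (A / B)) powr (\<delta> / (\<alpha> + \<beta>))"
        by (simp add: powr_powr t_def)
      then show ?thesis using AB by simp
    qed
    have AX: "A = X * 2 powr (t * \<alpha>)"
    proof -
      have "X * 2 powr (t * \<alpha>) = A powr (1 - \<theta>) * A powr \<theta>"
        unfolding t \<theta>[symmetric] X_def using AB by (simp add: powr_divide)
      also have "\<dots> = A" using AB by (simp add: powr_add[symmetric])
      finally show ?thesis by simp
    qed
    have BX: "B = X * 2 powr (- (t * \<beta>))"
    proof -
      have "X * 2 powr (- (t * \<beta>)) = B powr \<theta> * B powr (1 - \<theta>)"
        unfolding powr_minus t \<theta>1[symmetric] X_def using AB by (simp add: powr_divide)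
      also have "\<dots> = B" using AB by (simp add: powr_add[symmetric])
      finally show ?thesis by simp
    qed
    define j0 where "j0 = \<lfloor>t\<rfloor>"
    have "d j \<le> X * 2 powr \<gamma> * r ^ nat \<bar>j - j0\<bar>" for j
    proof -
      have "d j \<le> X * 2 powr (- \<gamma> * \<bar>real_of_int j - t\<bar>)"
      proof (cases "t \<le> real_of_int j")
        case True
        have "d j \<le> 2 powr (- (real_of_int j * \<alpha>)) * (X * 2 powr (t * \<alpha>))"
          using dA[of j] AX by simp
        also have "\<dots> = X * 2 powr (- (\<alpha> * (real_of_int j - t)))"
          by (simp add: powr_add[symmetric] algebra_simps)
        also have "\<dots> \<le> X * 2 powr (- \<gamma> * \<bar>real_of_int j - t\<bar>)"
          using True X by (intro mult_left_mono powr_mono) (auto simp: \<gamma>_def intro!: mult_right_mono)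
        finally show ?thesis .
      next
        case False
        have "d j \<le> 2 powr (real_of_int j * \<beta>) * (X * 2 powr (- (t * \<beta>)))"
          using dB[of j] BX by simp
        also have "\<dots> = X * 2 powr (- (\<beta> * (t - real_of_int j)))"
          by (simp add: powr_add[symmetric] algebra_simps)
        also have "\<dots> \<le> X * 2 powr (- \<gamma> * \<bar>real_of_int j - t\<bar>)"
          using False X by (intro mult_left_mono powr_mono) (auto simp: \<gamma>_def intro!: mult_right_mono)
        finally show ?thesis .
      qed
      also have "\<dots> \<le> X * 2 powr (\<gamma> * 1 + - \<gamma> * real (nat \<bar>j - j0\<bar>))"
      proof -
        have "real_of_int j0 \<le> t" "t < real_of_int j0 + 1" unfolding j0_def by linarith+
        \<comment> \<open>Rounding \<open>t\<close> down changes a distance by at most one, hence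
          the factor \<open>2 powr \<gamma>\<close>.\<close>
        then have "real (nat \<bar>j - j0\<bar>) - 1 \<le> \<bar>real_of_int j - t\<bar>" by simp
        then have "\<gamma> * (real (nat \<bar>j - j0\<bar>) - 1) \<le> \<gamma> * \<bar>real_of_int j - t\<bar>"
          using \<gamma> by (intro mult_left_mono) auto
        then show ?thesis
          using X by (intro mult_left_mono powr_mono) (auto simp: algebra_simps)
      qed
      also have "\<dots> = X * 2 powr \<gamma> * r ^ nat \<bar>j - j0\<bar>"
        by (simp only: r_pow powr_add mult_1_right mult.assoc)
      finally show ?thesis .
    qed
    then have "(\<Sum>j\<in>F. d j) \<le> (\<Sum>j\<in>F. X * 2 powr \<gamma> * r ^ nat \<bar>j - j0\<bar>)"
      by (intro sum_mono)
    also have "\<dots> = X * 2 powr \<gamma> * (\<Sum>j\<in>F. r ^ nat \<bar>j - j0\<bar>)"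
      by (simp add: sum_distrib_left)
    also have "\<dots> \<le> X * 2 powr \<gamma> * (2 / (1 - r))"
      using X r F by (intro mult_left_mono sum_int_power_le) auto
    finally show ?thesis by (simp add: C_def X_def mult_ac)
  qed
  moreover have "0 < C" using r by (simp add: C_def)
  ultimately show ?thesis using that by blast
qed

lemma powr_mult_le_affine:
  fixes a b :: real
  assumes "0 \<le> t" "t \<le> 1" "0 \<le> a" "0 \<le> b"
  shows "a powr (1 - t) * b powr t \<le> (1 - t) * a + t * b"
proof (cases "a = 0 \<or> b = 0")
  case False
  then show ?thesis using assms by (intro Youngs_inequality_0) auto
qed (use assms in auto)

text \<open>After division by \<open>I\<close> and \<open>J\<close>, the weighted mean inequality
  holds pointwise and integrates to at most 1. When one of them is zero, the product vanishes almost
  everywhere and no normalisation is possible.\<close>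

lemma nn_integral_Holder:
  fixes F G :: "'a \<Rightarrow> real"
  assumes t: "0 \<le> t" "t \<le> 1"
    and [measurable]: "F \<in> borel_measurable M" "G \<in> borel_measurable M"
    and F0: "\<And>x. 0 \<le> F x" and G0: "\<And>x. 0 \<le> G x" and I: "0 \<le> I" and J: "0 \<le> J"
    and F: "(\<integral>\<^sup>+x. ennreal (F x) \<partial>M) \<le> ennreal I" and G: "(\<integral>\<^sup>+x. ennreal (G x) \<partial>M) \<le> ennreal J"
  shows "(\<integral>\<^sup>+x. ennreal (F x powr (1 - t) * G x powr t) \<partial>M) \<le> ennreal (I powr (1 - t) * J powr t)"
proof (cases "I = 0 \<or> J = 0")
  case True
  have "AE x in M. F x = 0 \<or> G x = 0"
  proof (cases "I = 0")
    case True
    with F have "(\<integral>\<^sup>+x. ennreal (F x) \<partial>M) = 0" by simp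
    then have "AE x in M. ennreal (F x) = 0" by (subst (asm) nn_integral_0_iff_AE) auto
    then show ?thesis by eventually_elim (use F0 in \<open>simp add: ennreal_eq_0_iff antisym\<close>)
  next
    case False
    with \<open>I = 0 \<or> J = 0\<close> G have "(\<integral>\<^sup>+x. ennreal (G x) \<partial>M) = 0" by simp
    then have "AE x in M. ennreal (G x) = 0" by (subst (asm) nn_integral_0_iff_AE) auto
    then show ?thesis by eventually_elim (use G0 in \<open>simp add: ennreal_eq_0_iff antisym\<close>)
  qed
  then have "AE x in M. ennreal (F x powr (1 - t) * G x powr t) = 0" by eventually_elim auto
  then have "(\<integral>\<^sup>+x. ennreal (F x powr (1 - t) * G x powr t) \<partial>M) = (\<integral>\<^sup>+x. 0 \<partial>M)"
    by (rule nn_integral_cong_AE)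
  then show ?thesis by simp
next
  case False
  then have IJ: "0 < I" "0 < J" using I J by auto
  let ?X = "I powr (1 - t) * J powr t"
  have "(\<integral>\<^sup>+x. ennreal (F x powr (1 - t) * G x powr t) \<partial>M)
      \<le> (\<integral>\<^sup>+x. (ennreal (?X * (1 - t) / I) * ennreal (F x) + ennreal (?X * t / J) * ennreal (G x)) \<partial>M)"
  proof (rule nn_integral_mono)
    fix x
    have "F x powr (1 - t) * G x powr t = ?X * ((F x / I) powr (1 - t) * (G x / J) powr t)"
      using IJ F0[of x] G0[of x] by (simp add: powr_divide)
    also have "\<dots> \<le> ?X * ((1 - t) * (F x / I) + t * (G x / J))"
      using IJ t F0[of x] G0[of x] by (intro mult_left_mono powr_mult_le_affine) auto
    also have "\<dots> = ?X * (1 - t) / I * F x + ?X * t / J * G x"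
      by (simp add: algebra_simps)
    finally show "ennreal (F x powr (1 - t) * G x powr t)
        \<le> ennreal (?X * (1 - t) / I) * ennreal (F x) + ennreal (?X * t / J) * ennreal (G x)"
      using IJ t F0[of x] G0[of x]
      by (simp add: ennreal_mult[symmetric] ennreal_plus[symmetric] ennreal_leI del: ennreal_plus)
  qed
  also have "\<dots> = ennreal (?X * (1 - t) / I) * (\<integral>\<^sup>+x. ennreal (F x) \<partial>M) + ennreal (?X * t / J) * (\<integral>\<^sup>+x. ennreal (G x) \<partial>M)"
    by (simp add: nn_integral_add nn_integral_cmult)
  also have "\<dots> \<le> ennreal (?X * (1 - t) / I) * ennreal I + ennreal (?X * t / J) * ennreal J"
    by (intro add_mono mult_left_mono F G) auto
  also have "\<dots> = ennreal (?X * (1 - t) / I * I + ?X * t / J * J)"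
    using IJ t by (simp add: ennreal_mult[symmetric] ennreal_plus[symmetric] del: ennreal_plus)
  also have "?X * (1 - t) / I * I + ?X * t / J * J = ?X"
    using IJ by (simp add: field_simps)
  finally show ?thesis .
qed

section \<open>Extended powers and Lebesgue bounds for real-valued functions\<close>

lemma epowr_ennreal: "0 \<le> r \<Longrightarrow> epowr (ennreal r) a = ennreal (r powr a)"
  by (simp add: epowr_def)

lemma epowr_measurable [measurable]:
  assumes [measurable]: "F \<in> borel_measurable M"
  shows "(\<lambda>x. epowr (F x) a) \<in> borel_measurable M"
  unfolding epowr_def by measurable

lemma epowr_mono: "x \<le> y \<Longrightarrow> 0 \<le> a \<Longrightarrow> epowr x a \<le> epowr y a"
  by (auto simp: epowr_def top_unique less_top intro!: ennreal_leI powr_mono2 enn2real_mono)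

text \<open>Real-valued form of an upper bound on \<open>Lq_norm\<close>. For finite exponents the
  root is left out, so that the integrals enter Hoelder's inequality as they stand.\<close>

definition Lq_bound :: "ennreal \<Rightarrow> (real ^ 'n::finite \<Rightarrow> real) \<Rightarrow> real \<Rightarrow> bool" where
  "Lq_bound q A N \<longleftrightarrow> (if q = \<infinity> then AE x in lborel. A x \<le> N
     else (\<integral>\<^sup>+ x. ennreal (A x powr enn2real q) \<partial>lborel) \<le> ennreal (N powr enn2real q))"

lemma ennreal_ge_1_cases:
  assumes "1 \<le> (q::ennreal)"
  obtains "q = \<infinity>" | r where "q = ennreal r" "1 \<le> r"
  using assms
  by (cases q) (auto simp: ennreal_1[symmetric] simp del: ennreal_1)

text \<open>A finite norm forces finite values almost everywhere, so passing to
  \<open>enn2real\<close> changes the function only on a null set.\<close>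

lemma Lq_norm_finiteD:
  assumes [measurable]: "a \<in> borel_measurable lborel" and q: "1 \<le> q" and fin: "Lq_norm q a < \<infinity>"
  shows "AE x in lborel. a x = ennreal (enn2real (a x))"
    and "Lq_bound q (\<lambda>x. enn2real (a x)) (enn2real (Lq_norm q a))"
proof -
  let ?N = "Lq_norm q a"
  have N: "ennreal (enn2real ?N) = ?N" using fin by (simp add: less_top[symmetric])
  have "(AE x in lborel. a x = ennreal (enn2real (a x))) \<and> Lq_bound q (\<lambda>x. enn2real (a x)) (enn2real ?N)"
    using q
  proof (cases rule: ennreal_ge_1_cases)
    case 1
    then have "AE x in lborel. a x \<le> ?N" using esssup_AE[where f = a and M = lborel] by (simp add: Lq_norm_def)
    then have "AE x in lborel. a x = ennreal (enn2real (a x)) \<and> enn2real (a x) \<le> enn2real ?N"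
    proof eventually_elim
      case (elim x)
      then have "a x < \<infinity>" using fin by auto
      with elim fin show ?case by (auto intro: enn2real_mono)
    qed
    then show ?thesis using 1 by (auto simp: Lq_bound_def)
  next
    case (2 r)
    let ?I = "\<integral>\<^sup>+ x. epowr (a x) r \<partial>lborel"
    have N_eq: "?N = epowr ?I (1 / r)" using 2 by (simp add: Lq_norm_def)
    then have I: "?I \<noteq> \<infinity>" using fin by (auto simp: epowr_def)
    then have "AE x in lborel. epowr (a x) r \<noteq> \<infinity>"
      by (intro nn_integral_PInf_AE) auto
    then have ae: "AE x in lborel. a x = ennreal (enn2real (a x))"
      by eventually_elim (auto simp: epowr_def less_top[symmetric] split: if_splits)
    have "(\<integral>\<^sup>+ x. ennreal (enn2real (a x) powr r) \<partial>lborel) \<le> ?I"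
      by (intro nn_integral_mono) (auto simp: epowr_def)
    also have "?I = ennreal (enn2real ?N powr r)"
      using I 2 unfolding N_eq by (simp add: epowr_def powr_powr less_top)
    finally show ?thesis using ae 2 by (simp add: Lq_bound_def)
  qed
  then show "AE x in lborel. a x = ennreal (enn2real (a x))"
    and "Lq_bound q (\<lambda>x. enn2real (a x)) (enn2real ?N)" by blast+
qed

text \<open>The degenerate case of one infinite exponent: the bounded factor is taken out as a
  constant, and \<open>r = \<theta> * P\<close> is what remains of the relation between the
  exponents.\<close>

lemma Lq_bound_Holder_infinity:
  fixes A B :: "real ^ 'n::finite \<Rightarrow> real"
  assumes [measurable]: "A \<in> borel_measurable lborel" "B \<in> borel_measurable lborel"
    and A0: "\<And>x. 0 \<le> A x" and B0: "\<And>x. 0 \<le> B x" and N: "0 \<le> N0" "0 \<le> N1"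
    and A: "AE x in lborel. A x \<le> N0" and B: "(\<integral>\<^sup>+ x. ennreal (B x powr r) \<partial>lborel) \<le> ennreal (N1 powr r)"
    and \<theta>: "0 < \<theta>" "\<theta> < 1" and P: "0 < P" and r: "r = \<theta> * P"
  shows "(\<integral>\<^sup>+ x. ennreal ((A x powr (1 - \<theta>) * B x powr \<theta>) powr P) \<partial>lborel)
    \<le> ennreal ((N0 powr (1 - \<theta>) * N1 powr \<theta>) powr P)"
proof -
  have "(\<integral>\<^sup>+ x. ennreal ((A x powr (1 - \<theta>) * B x powr \<theta>) powr P) \<partial>lborel)
      \<le> (\<integral>\<^sup>+ x. ennreal (N0 powr ((1 - \<theta>) * P)) * ennreal (B x powr r) \<partial>lborel)"
  proof (rule nn_integral_mono_AE)
    show "AE x in lborel. ennreal ((A x powr (1 - \<theta>) * B x powr \<theta>) powr P)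
        \<le> ennreal (N0 powr ((1 - \<theta>) * P)) * ennreal (B x powr r)"
      using A
    proof eventually_elim
      case (elim x)
      have "(A x powr (1 - \<theta>) * B x powr \<theta>) powr P = A x powr ((1 - \<theta>) * P) * B x powr r"
        using A0 B0 by (simp add: powr_mult powr_powr r)
      also have "\<dots> \<le> N0 powr ((1 - \<theta>) * P) * B x powr r"
        using elim A0 \<theta> P by (intro mult_right_mono powr_mono2) auto
      finally show ?case by (simp add: ennreal_mult[symmetric] ennreal_leI)
    qed
  qed
  also have "\<dots> = ennreal (N0 powr ((1 - \<theta>) * P)) * (\<integral>\<^sup>+ x. ennreal (B x powr r) \<partial>lborel)"
    by (rule nn_integral_cmult) simp
  also have "\<dots> \<le> ennreal (N0 powr ((1 - \<theta>) * P)) * ennreal (N1 powr r)"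
    by (intro mult_left_mono B) auto
  also have "\<dots> = ennreal ((N0 powr (1 - \<theta>) * N1 powr \<theta>) powr P)"
    using N by (simp add: ennreal_mult[symmetric] powr_mult powr_powr r)
  finally show ?thesis .
qed

text \<open>Two infinite exponents would make \<open>1 / P\<close> vanish. If exactly one is
  infinite, the previous lemma applies, possibly with the roles of \<open>A\<close> and
  \<open>B\<close> exchanged and \<theta> replaced by \<open>1 - \<theta>\<close>.\<close>

lemma Lq_bound_Holder:
  fixes A B :: "real ^ 'n::finite \<Rightarrow> real"
  assumes [measurable]: "A \<in> borel_measurable lborel" "B \<in> borel_measurable lborel"
    and A0: "\<And>x. 0 \<le> A x" and B0: "\<And>x. 0 \<le> B x" and N: "0 \<le> N0" "0 \<le> N1"
    and q0: "1 \<le> q0" and q1: "1 \<le> q1" and P: "1 \<le> P" and \<theta>: "0 < \<theta>" "\<theta> < 1"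
    and A: "Lq_bound q0 A N0" and B: "Lq_bound q1 B N1"
    and p: "1 / ennreal P = ennreal (1 - \<theta>) / q0 + ennreal \<theta> / q1"
  shows "(\<integral>\<^sup>+ x. ennreal ((A x powr (1 - \<theta>) * B x powr \<theta>) powr P) \<partial>lborel)
    \<le> ennreal ((N0 powr (1 - \<theta>) * N1 powr \<theta>) powr P)"
proof -
  have P1: "1 / ennreal P = ennreal (1 / P)"
    using P divide_ennreal[of 1 P] by simp
  have P0: "0 < P" using P by simp
  show ?thesis using q0
  proof (cases rule: ennreal_ge_1_cases)
    case q0: 1
    show ?thesis using q1
    proof (cases rule: ennreal_ge_1_cases)
      case 1
      then have "1 / ennreal P = 0" using p q0 by simp
      then show ?thesis using P by simp
    next
      case (2 r1)
      then have "ennreal (1 / P) = ennreal (\<theta> / r1)" using p q0 P1 \<theta> by (simp add: divide_ennreal)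
      then have "r1 = \<theta> * P" using 2 P \<theta> by (simp add: ennreal_inj field_simps)
      then show ?thesis
        using A B q0 2 by (intro Lq_bound_Holder_infinity[OF assms(1-6) _ _ \<theta> P0]) (auto simp: Lq_bound_def)
    qed
  next
    case q0: (2 r0)
    show ?thesis using q1
    proof (cases rule: ennreal_ge_1_cases)
      case 1
      then have "ennreal (1 / P) = ennreal ((1 - \<theta>) / r0)" using p q0 P1 \<theta> by (simp add: divide_ennreal)
      then have "r0 = (1 - \<theta>) * P" using q0 P \<theta> by (simp add: ennreal_inj field_simps)
      moreover have "0 < 1 - \<theta>" "1 - \<theta> < 1" using \<theta> by auto
      ultimately have "(\<integral>\<^sup>+ x. ennreal ((B x powr (1 - (1 - \<theta>)) * A x powr (1 - \<theta>)) powr P) \<partial>lborel)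
          \<le> ennreal ((N1 powr (1 - (1 - \<theta>)) * N0 powr (1 - \<theta>)) powr P)"
        using A B q0 1 by (intro Lq_bound_Holder_infinity[OF assms(2,1,4,3,6,5) _ _ _ _ P0]) (auto simp: Lq_bound_def)
      then show ?thesis by (simp add: mult.commute)
    next
      case (2 r1)
      have "ennreal (1 / P) = ennreal ((1 - \<theta>) / r0 + \<theta> / r1)"
        using p q0 P1 \<theta> 2 by (simp add: divide_ennreal ennreal_plus[symmetric] del: ennreal_plus)
      then have eq: "1 / P = (1 - \<theta>) / r0 + \<theta> / r1"
        using q0 2 P \<theta> by (subst (asm) ennreal_inj) auto
      \<comment> \<open>The share of \<open>B\<close> in the relation of the exponents multiplied by
        \<open>P\<close>; the share of \<open>A\<close> is then \<open>1 - t\<close>. This choice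
        makes the powers in \<open>e\<close> match.\<close>
      define t where "t = P * (\<theta> / r1)"
      have t1: "1 - t = P * ((1 - \<theta>) / r0)"
      proof -
        have "1 = P * (1 / P)" using P by simp
        also have "\<dots> = P * ((1 - \<theta>) / r0) + t" unfolding eq t_def by (simp add: algebra_simps)
        finally show ?thesis by simp
      qed
      have t: "0 \<le> t" "0 \<le> 1 - t"
        unfolding t1 using q0 2 P \<theta> by (auto simp: t_def)
      have e: "r1 * t = \<theta> * P" "r0 * (1 - t) = (1 - \<theta>) * P"
        unfolding t1 using q0 2 by (auto simp: t_def)
      have *: "(u powr r0) powr (1 - t) * (v powr r1) powr t = (u powr (1 - \<theta>) * v powr \<theta>) powr P"
        if "0 \<le> u" "0 \<le> v" for u v :: real
        using that by (simp add: powr_powr powr_mult e)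
      have "(\<integral>\<^sup>+ x. ennreal ((A x powr r0) powr (1 - t) * (B x powr r1) powr t) \<partial>lborel)
          \<le> ennreal ((N0 powr r0) powr (1 - t) * (N1 powr r1) powr t)"
        using A B q0 2 t by (intro nn_integral_Holder) (auto simp: Lq_bound_def)
      then show ?thesis using A0 B0 N by (simp add: *)
    qed
  qed
qed

lemma Lq_norm_interpolation:
  fixes a b h :: "real ^ 'n::finite \<Rightarrow> ennreal"
  assumes am [measurable]: "a \<in> borel_measurable lborel" and bm [measurable]: "b \<in> borel_measurable lborel"
    and hm [measurable]: "h \<in> borel_measurable lborel"
    and q0: "1 \<le> q0" and q1: "1 \<le> q1" and p: "1 \<le> p" and \<theta>: "0 < \<theta>" "\<theta> < 1"
    and pq: "1 / p = ennreal (1 - \<theta>) / q0 + ennreal \<theta> / q1"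
    and a: "Lq_norm q0 a < \<infinity>" and b: "Lq_norm q1 b < \<infinity>" and C: "0 < C"
    and h: "AE x in lborel. h x \<le> ennreal C * epowr (a x) (1 - \<theta>) * epowr (b x) \<theta>"
  shows "Lq_norm p h \<le> ennreal C * epowr (Lq_norm q0 a) (1 - \<theta>) * epowr (Lq_norm q1 b) \<theta>"
  using p
proof (cases rule: ennreal_ge_1_cases)
  case 1
  then have "ennreal (1 - \<theta>) / q0 + ennreal \<theta> / q1 = 0" using pq by simp
  then have q: "q0 = \<infinity>" "q1 = \<infinity>" using \<theta> by auto
  have "AE x in lborel. h x \<le> ennreal C * epowr (esssup lborel a) (1 - \<theta>) * epowr (esssup lborel b) \<theta>"
    using h esssup_AE[where f = a and M = lborel] esssup_AE[where f = b and M = lborel]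
  proof eventually_elim
    case (elim x)
    note elim(1)
    also have "ennreal C * epowr (a x) (1 - \<theta>) * epowr (b x) \<theta>
        \<le> ennreal C * epowr (esssup lborel a) (1 - \<theta>) * epowr (esssup lborel b) \<theta>"
      using elim \<theta> by (intro mult_mono epowr_mono) auto
    finally show ?case .
  qed
  then show ?thesis using 1 q by (auto simp: Lq_norm_def)
next
  case (2 P)
  define A where "A x = enn2real (a x)" for x
  define B where "B x = enn2real (b x)" for x
  define N0 where "N0 = enn2real (Lq_norm q0 a)"
  define N1 where "N1 = enn2real (Lq_norm q1 b)"
  have N: "Lq_norm q0 a = ennreal N0" "Lq_norm q1 b = ennreal N1" "0 \<le> N0" "0 \<le> N1"
    using a b by (auto simp: N0_def N1_def less_top[symmetric])
  have aA: "AE x in lborel. a x = ennreal (A x)" and A: "Lq_bound q0 A N0"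
    using Lq_norm_finiteD[OF am q0 a] unfolding A_def N0_def by auto
  have bB: "AE x in lborel. b x = ennreal (B x)" and B: "Lq_bound q1 B N1"
    using Lq_norm_finiteD[OF bm q1 b] unfolding B_def N1_def by auto
  have AB0: "0 \<le> A x" "0 \<le> B x" for x by (auto simp: A_def B_def)
  have Am [measurable]: "A \<in> borel_measurable lborel" and Bm [measurable]: "B \<in> borel_measurable lborel"
    unfolding A_def B_def by measurable
  let ?X = "N0 powr (1 - \<theta>) * N1 powr \<theta>"
  have "(\<integral>\<^sup>+ x. epowr (h x) P \<partial>lborel)
      \<le> (\<integral>\<^sup>+ x. ennreal (C powr P) * ennreal ((A x powr (1 - \<theta>) * B x powr \<theta>) powr P) \<partial>lborel)"
  proof (rule nn_integral_mono_AE)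
    show "AE x in lborel. epowr (h x) P \<le> ennreal (C powr P) * ennreal ((A x powr (1 - \<theta>) * B x powr \<theta>) powr P)"
      using h aA bB
    proof eventually_elim
      case (elim x)
      have "h x \<le> ennreal (C * (A x powr (1 - \<theta>) * B x powr \<theta>))"
        using elim(1) C AB0 unfolding elim(2,3)
        by (simp add: epowr_ennreal ennreal_mult mult.assoc)
      then have "epowr (h x) P \<le> epowr (ennreal (C * (A x powr (1 - \<theta>) * B x powr \<theta>))) P"
        using 2 by (intro epowr_mono) auto
      also have "\<dots> = ennreal (C powr P * (A x powr (1 - \<theta>) * B x powr \<theta>) powr P)"
        using C AB0 by (subst epowr_ennreal) (auto simp: powr_mult)
      finally show ?case by (simp only: ennreal_mult powr_ge_zero)
    qed
  qed
  also have "\<dots> = ennreal (C powr P) * (\<integral>\<^sup>+ x. ennreal ((A x powr (1 - \<theta>) * B x powr \<theta>) powr P) \<partial>lborel)"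
    by (rule nn_integral_cmult) measurable
  also have "\<dots> \<le> ennreal (C powr P) * ennreal (?X powr P)"
    using pq 2 by (intro mult_left_mono Lq_bound_Holder[OF Am Bm AB0 N(3,4) q0 q1 _ \<theta> A B]) auto
  also have "\<dots> = ennreal ((C * ?X) powr P)"
    using C N by (simp add: ennreal_mult[symmetric] powr_mult)
  finally have "epowr (\<integral>\<^sup>+ x. epowr (h x) P \<partial>lborel) (1 / P) \<le> epowr (ennreal ((C * ?X) powr P)) (1 / P)"
    using 2 by (intro epowr_mono) auto
  also have "\<dots> = ennreal (C * ?X)"
    using C N 2 by (simp add: epowr_ennreal powr_powr)
  finally show ?thesis
    using 2 C N by (simp add: Lq_norm_def epowr_ennreal ennreal_mult mult.assoc)
qed

text \<open>For a finite exponent \<open>r \<ge> 1\<close>, \<open>A\<close> is at most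
  \<open>1 + A powr r\<close>. A weight that is both integrable and bounded handles the two summands
  separately, without a conjugate exponent.\<close>

lemma Lq_bound_integrable_mult:
  fixes A w :: "real ^ 'n::finite \<Rightarrow> real"
  assumes [measurable]: "A \<in> borel_measurable lborel" and A0: "\<And>x. 0 \<le> A x" and q: "1 \<le> q" and A: "Lq_bound q A N"
    and w: "integrable lborel w" and W: "\<And>x. \<bar>w x\<bar> \<le> W"
  shows "integrable lborel (\<lambda>x. A x * w x)"
  using q
proof (cases rule: ennreal_ge_1_cases)
  case 1
  show ?thesis
  proof (rule Bochner_Integration.integrable_bound)
    show "integrable lborel (\<lambda>x. N * w x)" using w by simp
    have "AE x in lborel. A x \<le> N" using A 1 by (simp add: Lq_bound_def)
    then show "AE x in lborel. norm (A x * w x) \<le> norm (N * w x)"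
    proof eventually_elim
      case (elim x)
      then have "\<bar>A x\<bar> \<le> \<bar>N\<bar>" using A0[of x] by simp
      then show ?case by (simp add: abs_mult mult_right_mono)
    qed
  qed (use w in auto)
next
  case (2 r)
  have int: "integrable lborel (\<lambda>x. A x powr r)"
  proof (rule integrableI_bounded)
    have "(\<integral>\<^sup>+ x. ennreal (norm (A x powr r)) \<partial>lborel) \<le> ennreal (N powr r)"
      using A 2 by (simp add: Lq_bound_def)
    also have "\<dots> < \<infinity>" by simp
    finally show "(\<integral>\<^sup>+ x. ennreal (norm (A x powr r)) \<partial>lborel) < \<infinity>" .
  qed simp
  show ?thesis
  proof (rule Bochner_Integration.integrable_bound)
    show "integrable lborel (\<lambda>x. \<bar>w x\<bar> + W * A x powr r)" using w int by simp
    show "AE x in lborel. norm (A x * w x) \<le> norm (\<bar>w x\<bar> + W * A x powr r)"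
    proof (intro AE_I2)
      fix x
      have W0: "0 \<le> W" using W[of x] by simp
      have "A x \<le> 1 + A x powr r"
      proof (cases "A x \<le> 1")
        case False
        then have "A x powr 1 \<le> A x powr r" using 2 by (intro powr_mono) auto
        then show ?thesis using False by simp
      qed (simp add: add_increasing2)
      then have "A x * \<bar>w x\<bar> \<le> (1 + A x powr r) * \<bar>w x\<bar>" by (intro mult_right_mono) auto
      also have "\<dots> \<le> \<bar>w x\<bar> + W * A x powr r"
        using mult_left_mono[OF W[of x], of "A x powr r"] by (simp add: algebra_simps)
      finally show "norm (A x * w x) \<le> norm (\<bar>w x\<bar> + W * A x powr r)"
        using W0 A0[of x] by (simp add: abs_mult)
    qed
  qed (use w in auto)
qed

subsection \<open>Convergence of the Littlewood--Paley series\<close>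

lemma filterlim_symmetric_int_intervals:
  "filterlim (\<lambda>k. {- int k..int k}) (finite_subsets_at_top UNIV) sequentially"
  unfolding filterlim_finite_subsets_at_top
proof (intro allI impI)
  fix X :: "int set" assume X: "finite X \<and> X \<subseteq> UNIV"
  obtain K where K: "\<And>j. j \<in> X \<Longrightarrow> nat \<bar>j\<bar> \<le> K"
    using X finite_nat_set_iff_bounded_le[of "(\<lambda>j. nat \<bar>j\<bar>) ` X"] by auto
  show "\<forall>\<^sub>F k in sequentially. finite {- int k..int k} \<and> X \<subseteq> {- int k..int k} \<and> {- int k..int k} \<subseteq> UNIV"
    using eventually_ge_at_top[of K]
  proof eventually_elim
    case (elim k)
    have "j \<in> {- int k..int k}" if "j \<in> X" for j
      using K[OF that] elim by auto
    then show ?case by auto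
  qed
qed

text \<open>Bounded finite sums of norms give unordered summability, and the symmetric intervals
  eventually contain every finite set of indices.\<close>

lemma convergent_symmetric_partial_sums:
  fixes d :: "int \<Rightarrow> complex"
  assumes "\<And>F. finite F \<Longrightarrow> (\<Sum>j\<in>F. norm (d j)) \<le> K"
  shows "convergent (\<lambda>k. \<Sum>j\<in>{- int k..int k}. d j)"
proof -
  have "(\<lambda>j. norm (d j)) summable_on UNIV"
    using assms by (intro nonneg_bdd_above_summable_on) (auto simp: bdd_above_def)
  then have "d summable_on UNIV" by (rule abs_summable_summable)
  then obtain s where "(sum d \<longlongrightarrow> s) (finite_subsets_at_top UNIV)"
    by (auto simp: summable_on_def has_sum_def)
  from filterlim_compose[OF this filterlim_symmetric_int_intervals] show ?thesis
    by (auto simp: convergent_def)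
qed

theorem theorem1:
  fixes \<phi> :: "real ^ 'n::finite \<Rightarrow> real"
    and \<alpha> \<beta> \<theta> :: real
    and q0 q1 p :: ennreal
  assumes "lp_cutoff \<phi>"
    and "\<alpha> > 0" and "\<beta> > 0"
    and "q0 \<ge> 1" and "q1 \<ge> 1"
    and "\<theta> = \<alpha> / (\<alpha> + \<beta>)"
    and "p \<ge> 1"
    and "1 / p = ennreal (1 - \<theta>) / q0 + ennreal \<theta> / q1"
  shows "\<exists>C0::real. C0 > 0 \<and>
    (\<forall>f :: 'n distr. in_tl_inter \<phi> \<alpha> q0 (- \<beta>) q1 f \<longrightarrow>
      (\<exists>g. represents g f \<and>
        (AE x in lborel. ennreal (norm (g x))
            \<le> ennreal C0 * epowr (tl_sup \<phi> \<alpha> f x) (1 - \<theta>) * epowr (tl_sup \<phi> (- \<beta>) f x) \<theta>) \<and>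
        Lq_norm p (\<lambda>x. ennreal (norm (g x)))
            \<le> ennreal C0 * epowr (tl_seminorm \<phi> \<alpha> q0 f) (1 - \<theta>)
                * epowr (tl_seminorm \<phi> (- \<beta>) q1 f) \<theta>))"
proof -
  obtain C where C: "0 < C" and sum_le: "\<And>A B (d :: int \<Rightarrow> real) F. \<lbrakk>0 \<le> A; 0 \<le> B; \<And>j. 0 \<le> d j;
      \<And>j. d j \<le> 2 powr (- (real_of_int j * \<alpha>)) * A; \<And>j. d j \<le> 2 powr (real_of_int j * \<beta>) * B; finite F\<rbrakk>
      \<Longrightarrow> (\<Sum>j\<in>F. d j) \<le> C * (A powr (1 - \<theta>) * B powr \<theta>)"
    using sum_geometric_interpolation[OF assms(2,3,6)] by metis
  have \<theta>: "0 < \<theta>" "\<theta> < 1" using assms(2,3) by (simp_all add: assms(6))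
  have "\<exists>g. represents g f \<and>
        (AE x in lborel. ennreal (norm (g x))
            \<le> ennreal C * epowr (tl_sup \<phi> \<alpha> f x) (1 - \<theta>) * epowr (tl_sup \<phi> (- \<beta>) f x) \<theta>) \<and>
        Lq_norm p (\<lambda>x. ennreal (norm (g x)))
            \<le> ennreal C * epowr (tl_seminorm \<phi> \<alpha> q0 f) (1 - \<theta>)
                * epowr (tl_seminorm \<phi> (- \<beta>) q1 f) \<theta>"
    if "in_tl_inter \<phi> \<alpha> q0 (- \<beta>) q1 f" for f :: "'n distr"
  proof -
    from that have f: "tempered f" and rec: "lp_reconstructs \<phi> f"
      and fin: "tl_seminorm \<phi> \<alpha> q0 f < \<infinity>" "tl_seminorm \<phi> (- \<beta>) q1 f < \<infinity>"
      by (auto simp: in_tl_inter_def)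
    define d where "d j = dyadic_block_fun \<phi> j f" for j
    have d_cont: "continuous_on UNIV (d j)" and d_rep: "represents (d j) (dyadic_block \<phi> j f)" for j
      using dyadic_block_fun[OF assms(1) f] by (auto simp: d_def)
    have dm [measurable]: "d j \<in> borel_measurable borel" for j
      by (rule borel_measurable_continuous_onI[OF d_cont])
    define a where "a = tl_sup \<phi> \<alpha> f"
    define b where "b = tl_sup \<phi> (- \<beta>) f"
    have tl_measurable: "tl_sup \<phi> s f \<in> borel_measurable lborel" for s
    proof -
      have "(\<lambda>x. SUP j::int. ennreal (2 powr (real_of_int j * s) * norm (d j x))) \<in> borel_measurable lborel"
        by measurable
      moreover have "tl_sup \<phi> s f = (\<lambda>x. SUP j::int. ennreal (2 powr (real_of_int j * s) * norm (d j x)))"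
        by (rule ext) (simp only: tl_sup_def d_def)
      ultimately show ?thesis by (simp only:)
    qed
    have am [measurable]: "a \<in> borel_measurable lborel" and bm [measurable]: "b \<in> borel_measurable lborel"
      by (simp_all only: a_def b_def tl_measurable)
    define A where "A x = enn2real (a x)" for x
    define B where "B x = enn2real (b x)" for x
    have Am [measurable]: "A \<in> borel_measurable lborel" and Bm [measurable]: "B \<in> borel_measurable lborel"
      unfolding A_def B_def by measurable
    have AB0: "0 \<le> A x" "0 \<le> B x" for x by (auto simp: A_def B_def)
    have fa: "Lq_norm q0 a < \<infinity>" and fb: "Lq_norm q1 b < \<infinity>"
      using fin by (auto simp: tl_seminorm_def a_def b_def)
    have A: "AE x in lborel. a x = ennreal (A x)" "Lq_bound q0 A (enn2real (Lq_norm q0 a))"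
      using Lq_norm_finiteD[OF am assms(4) fa] unfolding A_def by auto
    have B: "AE x in lborel. b x = ennreal (B x)" "Lq_bound q1 B (enn2real (Lq_norm q1 b))"
      using Lq_norm_finiteD[OF bm assms(5) fb] unfolding B_def by auto
    have tl_sup_bound: "norm (d j x) \<le> 2 powr (- (real_of_int j * s)) * r"
      if "tl_sup \<phi> s f x = ennreal r" "0 \<le> r" for j s x r
    proof -
      have "ennreal (2 powr (real_of_int j * s) * norm (d j x)) \<le> ennreal r"
        unfolding that(1)[symmetric] tl_sup_def d_def by (rule SUP_upper) simp
      then have "2 powr (real_of_int j * s) * norm (d j x) \<le> r" using that(2) by simp
      then have "2 powr (- (real_of_int j * s)) * (2 powr (real_of_int j * s) * norm (d j x))
          \<le> 2 powr (- (real_of_int j * s)) * r"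
        by (rule mult_left_mono) simp
      then show ?thesis by (simp add: mult.assoc[symmetric] powr_add[symmetric])
    qed
    \<comment> \<open>The quantifier over \<open>F\<close> stands inside the almost-everywhere
      statement: one null set, where \<open>a\<close> or \<open>b\<close> is infinite, serves all
      finite sets.\<close>
    have sum_bound: "AE x in lborel. \<forall>F. finite F \<longrightarrow> (\<Sum>j\<in>F. norm (d j x)) \<le> C * (A x powr (1 - \<theta>) * B x powr \<theta>)"
      using A(1) B(1)
    proof eventually_elim
      case (elim x)
      show ?case
      proof (intro allI impI sum_le)
        show "norm (d j x) \<le> 2 powr (- (real_of_int j * \<alpha>)) * A x" for j
          using elim AB0 by (intro tl_sup_bound) (auto simp: a_def)
        show "norm (d j x) \<le> 2 powr (real_of_int j * \<beta>) * B x" for j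
          using tl_sup_bound[of "- \<beta>" x "B x" j] elim AB0 by (auto simp: b_def)
      qed (auto simp: AB0)
    qed
    define S where "S k x = (\<Sum>j\<in>{- int k..int k}. d j x)" for k x
    have Sm [measurable]: "S k \<in> borel_measurable lborel" for k
      unfolding S_def by measurable
    \<comment> \<open>\<open>lim\<close> is total, so \<open>g\<close> is measurable as it stands;
      its values where the series diverges concern a null set only.\<close>
    define g where "g x = lim (\<lambda>k. S k x)" for x
    have gm [measurable]: "g \<in> borel_measurable lborel"
      unfolding g_def by measurable
    have lim: "AE x in lborel. (\<lambda>k. S k x) \<longlonglongrightarrow> g x"
      using sum_bound
    proof eventually_elim
      case (elim x)
      then have "convergent (\<lambda>k. S k x)"
        unfolding S_def by (intro convergent_symmetric_partial_sums) blast
      then show ?case unfolding g_def by (simp add: convergent_LIMSEQ_iff)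
    qed
    have S_le: "AE x in lborel. \<forall>k. norm (S k x) \<le> C * (A x powr (1 - \<theta>) * B x powr \<theta>)"
      using sum_bound
    proof eventually_elim
      case (elim x)
      show ?case
      proof
        fix k
        have "norm (S k x) \<le> (\<Sum>j\<in>{- int k..int k}. norm (d j x))"
          unfolding S_def by (rule norm_sum)
        also have "\<dots> \<le> C * (A x powr (1 - \<theta>) * B x powr \<theta>)" using elim by simp
        finally show "norm (S k x) \<le> C * (A x powr (1 - \<theta>) * B x powr \<theta>)" .
      qed
    qed
    have g_le: "AE x in lborel. ennreal (norm (g x)) \<le> ennreal C * epowr (a x) (1 - \<theta>) * epowr (b x) \<theta>"
      using lim S_le A(1) B(1)
    proof eventually_elim
      case (elim x)
      have "norm (g x) \<le> C * (A x powr (1 - \<theta>) * B x powr \<theta>)"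
        by (rule LIMSEQ_le_const2[OF tendsto_norm[OF elim(1)]]) (use elim(2) in auto)
      then have "ennreal (norm (g x)) \<le> ennreal (C * (A x powr (1 - \<theta>) * B x powr \<theta>))"
        by (rule ennreal_leI)
      also have "\<dots> = ennreal C * epowr (a x) (1 - \<theta>) * epowr (b x) \<theta>"
        unfolding elim(3,4) using C AB0 by (simp add: epowr_ennreal ennreal_mult mult.assoc)
      finally show ?case .
    qed
    have "represents g f"
      unfolding represents_def
    proof (intro conjI allI impI)
      show "g \<in> borel_measurable lborel" by (rule gm)
      fix \<eta> :: "real ^ 'n \<Rightarrow> complex" assume \<eta>: "schwartz \<eta>"
      have [measurable]: "\<eta> \<in> borel_measurable borel" by (intro smooth_measurable schwartz_smooth \<eta>)
      have \<eta>_int: "integrable lborel (\<lambda>x. norm (\<eta> x))"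
        by (intro integrable_norm rapidly_integrable_integrable schwartz_rapidly_integrable \<eta>)
      obtain W where W: "\<And>x. (1 + norm x) ^ 0 * norm (partial_derivs [] \<eta> x) \<le> W"
        using schwartzD[OF \<eta>] by metis
      \<comment> \<open>Linearising the geometric mean allows \<open>A\<close> and \<open>B\<close>
        to be tested against \<eta> separately, each with its own exponent.\<close>
      let ?w = "\<lambda>x. C * (A x * norm (\<eta> x) + B x * norm (\<eta> x))"
      have w_int: "integrable lborel ?w"
        using W by (intro integrable_mult_right Bochner_Integration.integrable_add
            Lq_bound_integrable_mult[OF Am AB0(1) assms(4) A(2) \<eta>_int, of W]
            Lq_bound_integrable_mult[OF Bm AB0(2) assms(5) B(2) \<eta>_int, of W]) auto
      have meas: "(\<lambda>x. g x * \<eta> x) \<in> borel_measurable lborel" "(\<lambda>x. S k x * \<eta> x) \<in> borel_measurable lborel" for k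
        by measurable
      have dom: "AE x in lborel. norm (S k x * \<eta> x) \<le> ?w x" for k
        using S_le
      proof eventually_elim
        case (elim x)
        have "A x powr (1 - \<theta>) * B x powr \<theta> \<le> (1 - \<theta>) * A x + \<theta> * B x"
          using \<theta> AB0 by (intro powr_mult_le_affine) auto
        also have "\<dots> \<le> A x + B x"
          using \<theta> AB0[of x] by (intro add_mono mult_left_le_one_le) auto
        finally have "C * (A x powr (1 - \<theta>) * B x powr \<theta>) \<le> C * (A x + B x)"
          using C by (intro mult_left_mono) auto
        then have "norm (S k x) * norm (\<eta> x) \<le> C * (A x + B x) * norm (\<eta> x)"
          using elim by (intro mult_right_mono) (auto intro: order_trans)
        then show ?case by (simp add: norm_mult algebra_simps)
      qed
      have ptw: "AE x in lborel. (\<lambda>k. S k x * \<eta> x) \<longlonglongrightarrow> g x * \<eta> x"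
        using lim by eventually_elim (intro tendsto_intros)
      note dct = meas(1) meas(2) w_int ptw dom
      show "integrable lborel (\<lambda>x. g x * \<eta> x)"
        using dct by (rule integrable_dominated_convergence)
      have lim1: "(\<lambda>k. LINT x|lborel. S k x * \<eta> x) \<longlonglongrightarrow> (LINT x|lborel. g x * \<eta> x)"
        using dct by (rule integral_dominated_convergence)
      have S_eq: "(LINT x|lborel. S k x * \<eta> x) = (\<Sum>j\<in>{- int k..int k}. dyadic_block \<phi> j f \<eta>)" for k
      proof -
        have dj: "integrable lborel (\<lambda>x. d j x * \<eta> x)" "dyadic_block \<phi> j f \<eta> = (LINT x|lborel. d j x * \<eta> x)" for j
          using d_rep[of j] \<eta> by (auto simp: represents_def)
        show ?thesis
          unfolding S_def sum_distrib_right dj(2) using dj(1) by (intro Bochner_Integration.integral_sum)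
      qed
      \<comment> \<open>Reconstruction is a limit in two independent cut-offs; its diagonal consists
        of the symmetric partial sums \<open>S k\<close>.\<close>
      have "filterlim (\<lambda>k::nat. (k, k)) (at_top \<times>\<^sub>F at_top) sequentially"
        by (intro filterlim_Pair filterlim_ident)
      from filterlim_compose[OF rec[unfolded lp_reconstructs_def, rule_format, OF \<eta>] this]
      have "(\<lambda>k. LINT x|lborel. S k x * \<eta> x) \<longlonglongrightarrow> f \<eta>" by (simp add: S_eq)
      then show "f \<eta> = (LINT x|lborel. g x * \<eta> x)" using lim1 by (rule LIMSEQ_unique)
    qed
    moreover have "Lq_norm p (\<lambda>x. ennreal (norm (g x)))
        \<le> ennreal C * epowr (Lq_norm q0 a) (1 - \<theta>) * epowr (Lq_norm q1 b) \<theta>"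
      by (rule Lq_norm_interpolation[OF am bm _ assms(4,5,7) \<theta> assms(8) fa fb C g_le]) measurable
    ultimately show ?thesis
      using g_le unfolding tl_seminorm_def a_def b_def by blast
  qed
  with C show ?thesis by blast
qed

end
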